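(* Let $\tau>1$ and $\alpha>0$ be such that $\gamma:=\alpha(\tau-1)<1$, and for each $N$ let $G_N$ be the scale-free percolation random graph on the torus $\mathbb{T}_N$ with parameters $\alpha,\tau$. There exists a constant $c>0$ (not depending on $N$) such that, almost surely, for all $N$ large enough, $$t_{\rm mix}(G_N)\le (\log N)^c .$$
   Context: Scale-free percolation (SFP) on the torus. Fix $\tau>1$ and $\alpha>0$ and write $\gamma:=\alpha(\tau-1)$. The vertex set of $G_N$ is $\mathbb{T}_N=\{1,\dots,N\}\cong\mathbb{Z}/N\mathbb{Z}$, with torus distance $\|x-y\|:=|x-y|\wedge(N-|x-y|)$. To the vertices one associates i.i.d. random weights $(W_x)_{x\in\mathbb{T}_N}$ with Pareto law $\mathbb{P}(W_1\ge t)=t^{-(\tau-1)}$ for $t\ge1$ and $\mathbb{P}(W_1\ge t)=1$ for $t<1$. Given the weights, pairs of distinct vertices $x,y$ are joined by an (undirected) edge independently with probability $1-\exp(-W_xW_y/\|x-y\|^{\alpha})$, except that $x$ and $x+1$ are always joined by an edge, for all $x\in\mathbb{T}_N$ (with $N+1$ identified with $1$). The graphs for different $N$ live on a common probability space with measure $\mathbb{P}$; nothing is assumed about their joint law for different $N$. Mixing time. For a finite connected graph $G=(V,E)$ with degrees $D_x$, the lazy simple random walk on $G$ has transition matrix $P(x,x)=1/2$ and $P(x,y)=\frac{1}{2D_x}$ if $x,y$ are joined by an edge ($P(x,y)=0$ for other $y\ne x$); its reversible measure is $\pi(x)=D_x/\sum_{z\in V}D_z$. With $\|\mu-\nu\|_{\rm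 TV}=\frac12\sum_{x\in V}|\mu(x)-\nu(x)|$ and $d(n)=\sup_{x\in V}\|P^n(x,\cdot)-\pi\|_{\rm TV}$, set $t_{\rm mix}(G):=\inf\{n\in\mathbb{N}: d(n)<1/4\}$. *)

theory Defs
  imports "HOL-Probability.Probability"
begin

section \<open>Mixing time of the lazy simple random walk\<close>

text \<open>
  A finite simple graph is given by its vertex set \<open>V\<close> and its set \<open>E\<close> of edges, each
  edge being a two-element subset of \<open>V\<close>.
\<close>

definition vertex_degree :: "'v set \<Rightarrow> 'v set set \<Rightarrow> 'v \<Rightarrow> nat" where
  "vertex_degree V E x = card {y \<in> V. {x, y} \<in> E}"

definition lazy_walk :: "'v set \<Rightarrow> 'v set set \<Rightarrow> 'v \<Rightarrow> 'v \<Rightarrow> real" where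
  "lazy_walk V E x y =
     (if x = y then 1 / 2
      else if {x, y} \<in> E then 1 / (2 * real (vertex_degree V E x))
      else 0)"

fun lazy_walk_power :: "'v set \<Rightarrow> 'v set set \<Rightarrow> nat \<Rightarrow> 'v \<Rightarrow> 'v \<Rightarrow> real" where
  "lazy_walk_power V E 0 x y = (if x = y then 1 else 0)"
| "lazy_walk_power V E (Suc n) x y =
     (\<Sum>z\<in>V. lazy_walk V E x z * lazy_walk_power V E n z y)"

definition stationary :: "'v set \<Rightarrow> 'v set set \<Rightarrow> 'v \<Rightarrow> real" where
  "stationary V E x = real (vertex_degree V E x) / (\<Sum>z\<in>V. real (vertex_degree V E z))"

definition tv_dist :: "'v set \<Rightarrow> ('v \<Rightarrow> real) \<Rightarrow> ('v \<Rightarrow> real) \<Rightarrow> real" where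
  "tv_dist V \<mu> \<nu> = 1 / 2 * (\<Sum>x\<in>V. \<bar>\<mu> x - \<nu> x\<bar>)"

definition mixing_dist :: "'v set \<Rightarrow> 'v set set \<Rightarrow> nat \<Rightarrow> real" where
  "mixing_dist V E n = (SUP x\<in>V. tv_dist V (lazy_walk_power V E n x) (stationary V E))"

text \<open>The infimum is taken in \<open>enat\<close>, so that it is \<open>\<infinity>\<close> (and not \<open>0\<close>) over the empty set.\<close>

definition t_mix :: "'v set \<Rightarrow> 'v set set \<Rightarrow> enat" where
  "t_mix V E = Inf (enat ` {n. mixing_dist V E n < 1 / 4})"


section \<open>Scale-free percolation on the torus\<close>

definition torus :: "nat \<Rightarrow> nat set" where
  "torus N = {1..N}"

definition torus_dist :: "nat \<Rightarrow> nat \<Rightarrow> nat \<Rightarrow> real" where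
  "torus_dist N x y = min \<bar>real x - real y\<bar> (real N - \<bar>real x - real y\<bar>)"

definition torus_pairs :: "nat \<Rightarrow> nat set set" where
  "torus_pairs N = {{x, y} |x y. x \<in> torus N \<and> y \<in> torus N \<and> x \<noteq> y}"

text \<open>
  The successor of \<open>x\<close> on the torus is \<open>x mod N + 1\<close>. The intersection only matters for
  \<open>N = 1\<close>, where the successor of the single vertex is that vertex itself.
\<close>

definition cycle_edges :: "nat \<Rightarrow> nat set set" where
  "cycle_edges N = {{x, x mod N + 1} |x. x \<in> torus N} \<inter> torus_pairs N"

text \<open>
  \<open>W x\<close> is the weight of vertex \<open>x\<close> and \<open>G \<omega>\<close> the edge set of the graph. An unordered
  pair of distinct vertices is represented by the ordered pair \<open>(x, y)\<close> with \<open>x < y\<close>. The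
  last assumption is conditional independence of the edge events given the
  \<open>\<sigma>\<close>-algebra generated by the weights, together with their conditional probabilities:
  it is the product formula for every finite family of these events.
\<close>

locale scale_free_percolation = prob_space M
  for M :: "'a measure" and \<alpha> \<tau> :: real and N :: nat
    and W :: "nat \<Rightarrow> 'a \<Rightarrow> real" and G :: "'a \<Rightarrow> nat set set" +
  assumes weights_indep: "indep_vars (\<lambda>_. borel) W (torus N)"
    and weights_pareto:
      "\<And>x t. x \<in> torus N \<Longrightarrow>
         prob {\<omega> \<in> space M. W x \<omega> \<ge> t} = (if t \<ge> 1 then t powr (- (\<tau> - 1)) else 1)"
    and edges_pairs: "\<And>\<omega>. \<omega> \<in> space M \<Longrightarrow> G \<omega> \<subseteq> torus_pairs N"
    and edges_measurable:
      "\<And>x y. x \<in> torus N \<Longrightarrow> y \<in> torus N \<Longrightarrow> {\<omega> \<in> space M. {x, y} \<in> G \<omega>} \<in> events"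
    and cycle_present: "\<And>\<omega>. \<omega> \<in> space M \<Longrightarrow> cycle_edges N \<subseteq> G \<omega>"
    and edges_cond_indep:
      "\<And>J. J \<subseteq> {(x, y). x \<in> torus N \<and> y \<in> torus N \<and> x < y \<and> {x, y} \<notin> cycle_edges N} \<Longrightarrow>
         AE \<omega> in M.
           real_cond_exp M
             (vimage_algebra (space M) (\<lambda>\<omega>. \<lambda>x\<in>torus N. W x \<omega>) (PiM (torus N) (\<lambda>_. borel)))
             (indicator {\<omega> \<in> space M. \<forall>(x, y)\<in>J. {x, y} \<in> G \<omega>}) \<omega> =
           (\<Prod>(x, y)\<in>J. 1 - exp (- (W x \<omega> * W y \<omega>) / torus_dist N x y powr \<alpha>))"

end

theory Submission
  imports Defs "HOL-Real_Asymp.Real_Asymp"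
begin

text \<open>
  Conditionally on the weights the graph has independent edges, and it turns out to have no
  bottleneck: with probability \<open>1 - O(N\<^sup>-\<^sup>2)\<close> its conductance is at least a negative power of
  \<open>ln N\<close>. Cheeger's inequality then makes the spectral gap of the lazy walk at least a negative
  power of \<open>ln N\<close>, and since the stationary distribution is at least \<open>N\<^sup>-\<^sup>2\<close> everywhere, the
  mixing time is polylogarithmic (\<open>t_mix_le_of_isoperimetry\<close>). The failure probabilities are
  summable, so the Borel--Cantelli lemma gives the almost sure statement.

  The scale of everything is set by \<open>A = N\<^sup>\<alpha>\<close>: two vertices with \<open>W x * W y \<ge> A\<close> are joined with
  probability at least one half, wherever they lie on the torus, because distances are at most
  \<open>N\<close>. Put \<open>\<theta> = min 1 (\<tau> - 1)\<close> and let the profile of a vertex be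
  \<open>g x = N * min 1 ((W x / A) powr \<theta>)\<close>. The proof compares degrees and cuts with \<open>g\<close>.

  \<^item> \<^emph>\<open>Degrees.\<close> \<open>E (min 1 (s * W))\<close> is of order \<open>s powr \<theta>\<close> up to a logarithm. Summing this with
    \<open>s = W x / \<parallel>x - y\<parallel>\<^sup>\<alpha>\<close> over the torus gives \<open>g x\<close> up to logarithms, because
    \<open>\<alpha> * \<theta> < 1\<close> makes the long distances dominate (\<open>expected_degree_bound\<close>).
    The degrees concentrate, so each is at most \<open>g x\<close> times a power of \<open>ln N\<close>.

  \<^item> \<^emph>\<open>Expected cuts.\<close> Given the weights, the expected number of edges between \<open>S\<close> and its
    complement is at least \<open>min (g S) (g (- S))\<close> divided by a logarithm. If \<open>\<tau> \<ge> 2\<close> this is simple: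
    already the probability \<open>min 1 (W x / A) / 2\<close> of an edge from \<open>x\<close> to a vertex of
    weight one accounts for \<open>g x\<close>. If \<open>\<tau> < 2\<close>, the mass \<open>g x\<close> sits on the hubs of weight at least
    \<open>A / W x\<close>, and one follows the dyadic levels of hubs until the majority of a level changes
    sides (\<open>mean_cut_isoperimetry_levels\<close>). Here \<open>\<alpha> * (\<tau> - 1) < 1\<close> enters once more:
    there are about \<open>N powr (1 - \<alpha> * (\<tau> - 1))\<close> vertices of weight at least \<open>A\<close>, hence the number
    of vertices in each level concentrates.

  \<^item> \<^emph>\<open>Actual cuts.\<close> Every vertex contributes at least \<open>N powr (1 - \<alpha> * \<theta>)\<close> to \<open>g\<close>, much more than
    the \<open>ln N\<close> which each vertex costs in a union bound over the sets \<open>S\<close>. Thus all cuts are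
    simultaneously comparable with their expectations (\<open>all_cuts_lower_tail\<close>).

  All concentration bounds come from one identity: for finitely many distinct pairs \<open>e\<close>,
  conditionally on the weights, the expectation of \<open>\<Prod>e. 1 + s * 1\<^sub>e\<close> is \<open>\<Prod>e. 1 + s * p\<^sub>e\<close>. It follows
  from the product formula for the presence of edges by expanding the product. Taking \<open>s = 1\<close> gives
  \<open>2\<close> to the power of the number of edges and hence upper tails, and \<open>s = - 1 / 2\<close> gives lower tails.
\<close>

section \<open>Conductance and mixing of the lazy walk\<close>

text \<open>
  A finite network: \<open>a x y\<close> is the conductance of the edge between \<open>x\<close> and \<open>y\<close>. For a graph it is the
  adjacency matrix.
\<close>

locale network =
  fixes V :: "'v set" and a :: "'v \<Rightarrow> 'v \<Rightarrow> real"
  assumes finite_V [simp]: "finite V"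
    and a_sym: "a x y = a y x"
    and a_nonneg: "0 \<le> a x y"
begin

definition deg :: "'v \<Rightarrow> real" where "deg x = (\<Sum>y\<in>V. a x y)"
definition vol :: "'v set \<Rightarrow> real" where "vol S = (\<Sum>x\<in>S. deg x)"
definition cut :: "'v set \<Rightarrow> real" where "cut S = (\<Sum>x\<in>S. \<Sum>y\<in>V - S. a x y)"
definition energy :: "('v \<Rightarrow> real) \<Rightarrow> real" where
  "energy f = (\<Sum>x\<in>V. \<Sum>y\<in>V. a x y * (f x - f y)\<^sup>2)"

lemma deg_nonneg: "0 \<le> deg x"
  unfolding deg_def by (intro sum_nonneg a_nonneg)

lemma vol_mono: "S \<subseteq> T \<Longrightarrow> T \<subseteq> V \<Longrightarrow> vol S \<le> vol T"
  unfolding vol_def using finite_subset[OF _ finite_V] by (intro sum_mono2 deg_nonneg) auto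

lemma sum_swap_a: "(\<Sum>x\<in>V. \<Sum>y\<in>V. a x y * F y x) = (\<Sum>x\<in>V. \<Sum>y\<in>V. a x y * F x y)"
  by (subst sum.swap) (simp add: a_sym)

lemma sum_a_fst: "(\<Sum>x\<in>V. \<Sum>y\<in>V. a x y * F x) = (\<Sum>x\<in>V. deg x * F x)"
  by (simp add: deg_def sum_distrib_right)

lemma sum_a_snd: "(\<Sum>x\<in>V. \<Sum>y\<in>V. a x y * F y) = (\<Sum>x\<in>V. deg x * F x)"
  using sum_swap_a[of "\<lambda>x y. F x"] sum_a_fst[of F] by simp

lemma cut_altdef:
  assumes "S \<subseteq> V"
  shows "2 * cut S = (\<Sum>x\<in>V. \<Sum>y\<in>V. a x y * (if (x \<in> S) = (y \<in> S) then 0 else 1))"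
proof -
  have c: "cut S = (\<Sum>x\<in>V. \<Sum>y\<in>V. a x y * (if x \<in> S \<and> y \<notin> S then 1 else 0))"
  proof -
    have "(\<Sum>x\<in>V. \<Sum>y\<in>V. a x y * (if x \<in> S \<and> y \<notin> S then 1 else 0))
        = (\<Sum>x\<in>V. if x \<in> S then (\<Sum>y\<in>V. if y \<notin> S then a x y else 0) else 0)"
      by (intro sum.cong refl) (auto intro!: sum.cong)
    also have "\<dots> = (\<Sum>x\<in>V \<inter> S. \<Sum>y\<in>V \<inter> - S. a x y)"
      by (simp add: sum.inter_restrict)
    also have "V \<inter> S = S" using assms by auto
    also have "V \<inter> - S = V - S" by auto
    finally show ?thesis by (simp add: cut_def)
  qed
  have "2 * cut S = cut S + (\<Sum>x\<in>V. \<Sum>y\<in>V. a x y * (if y \<in> S \<and> x \<notin> S then 1 else 0))"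
    unfolding c using sum_swap_a[of "\<lambda>x y. if x \<in> S \<and> y \<notin> S then 1 else 0"] by simp
  also have "\<dots> = (\<Sum>x\<in>V. \<Sum>y\<in>V. a x y * (if (x \<in> S) = (y \<in> S) then 0 else 1))"
    unfolding c by (simp add: sum.distrib[symmetric]) (auto intro!: sum.cong)
  finally show ?thesis .
qed

text \<open>
  A discrete coarea formula: for nonnegative \<open>g\<close>, both sides are integrals over the level sets
  \<open>{x. g x > t}\<close>, of their volume and of their cut. The induction peels off the lowest
  positive level, which shrinks the support of \<open>g\<close>.
\<close>

lemma coarea_cut_bound:
  assumes "\<And>x. x \<in> V \<Longrightarrow> 0 \<le> g x"
    and "\<And>S. S \<subseteq> {x \<in> V. 0 < g x} \<Longrightarrow> h * vol S \<le> cut S"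
  shows "2 * h * (\<Sum>x\<in>V. deg x * g x) \<le> (\<Sum>x\<in>V. \<Sum>y\<in>V. a x y * \<bar>g x - g y\<bar>)"
  using assms
proof (induction "card {x \<in> V. 0 < g x}" arbitrary: g rule: less_induct)
  case (less g)
  define S where "S = {x \<in> V. 0 < g x}"
  have S: "S \<subseteq> V" "finite S" unfolding S_def by auto
  show ?case
  proof (cases "S = {}")
    case True
    then have "g x = 0" if "x \<in> V" for x
      using that less.prems(1)[of x] unfolding S_def by force
    then show ?thesis by (simp add: sum_nonneg a_nonneg)
  next
    case False
    define m where "m = Min (g ` S)"
    have m: "m \<in> g ` S" unfolding m_def using S False by (intro Min_in) auto
    have mle: "m \<le> g x" if "x \<in> S" for x
      unfolding m_def using S that by (intro Min_le) auto
    have mpos: "0 < m" using m S_def by auto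
    define g' where "g' x = (if x \<in> S then g x - m else 0)" for x
    have out: "g x = 0" if "x \<in> V" "x \<notin> S" for x
      using that less.prems(1)[of x] unfolding S_def by force
    have g'0: "0 \<le> g' x" for x unfolding g'_def using mle by auto
    have sub: "{x \<in> V. 0 < g' x} \<subset> S"
      using m S unfolding g'_def by (auto split: if_splits)
    have "card {x \<in> V. 0 < g' x} < card S" using sub S by (intro psubset_card_mono) auto
    then have IH: "2 * h * (\<Sum>x\<in>V. deg x * g' x) \<le> (\<Sum>x\<in>V. \<Sum>y\<in>V. a x y * \<bar>g' x - g' y\<bar>)"
      using less.prems(2) sub g'0 unfolding S_def by (intro less.hyps) auto
    have D: "(\<Sum>x\<in>V. deg x * g x) = (\<Sum>x\<in>V. deg x * g' x) + m * vol S"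
    proof -
      have "m * vol S = (\<Sum>x\<in>V. if x \<in> S then m * deg x else 0)"
        unfolding vol_def using S by (simp add: sum.inter_restrict[symmetric] Int_absorb1 sum_distrib_left)
      then show ?thesis
        by (simp add: sum.distrib[symmetric]) (auto intro!: sum.cong simp: g'_def out algebra_simps)
    qed
    have A: "(\<Sum>x\<in>V. \<Sum>y\<in>V. a x y * \<bar>g x - g y\<bar>)
        = (\<Sum>x\<in>V. \<Sum>y\<in>V. a x y * \<bar>g' x - g' y\<bar>) + m * (2 * cut S)"
    proof -
      have "\<bar>g x - g y\<bar> = \<bar>g' x - g' y\<bar> + m * (if (x \<in> S) = (y \<in> S) then 0 else 1)"
        if "x \<in> V" "y \<in> V" for x y
        using out[of x] out[of y] mle[of x] mle[of y] that mpos by (auto simp: g'_def)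
      then show ?thesis
        unfolding cut_altdef[OF S(1)] sum_distrib_left sum.distrib[symmetric]
        by (intro sum.cong refl) (simp add: algebra_simps)
    qed
    have "m * (h * vol S) \<le> m * cut S"
      using less.prems(2)[of S] mpos unfolding S_def by (intro mult_left_mono) auto
    then show ?thesis using IH D A by (simp add: algebra_simps)
  qed
qed

text \<open>
  Applied to \<open>g\<^sup>2\<close>, the coarea bound controls the volume term by the sum of \<open>a x y * \<bar>g x - g y\<bar> * (g x + g y)\<close>;
  the Cauchy--Schwarz inequality separates the energy of \<open>g\<close>, at the price of the square of \<open>h\<close>.
\<close>

lemma cheeger_nonneg:
  assumes h: "0 \<le> h" and g: "\<And>x. x \<in> V \<Longrightarrow> 0 \<le> g x"
    and iso: "\<And>S. S \<subseteq> {x \<in> V. 0 < g x} \<Longrightarrow> h * vol S \<le> cut S"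
  shows "h\<^sup>2 * (\<Sum>x\<in>V. deg x * (g x)\<^sup>2) \<le> energy g"
proof -
  define B where "B = (\<Sum>x\<in>V. deg x * (g x)\<^sup>2)"
  have B0: "0 \<le> B" unfolding B_def by (intro sum_nonneg mult_nonneg_nonneg deg_nonneg) auto
  have E0: "0 \<le> energy g" unfolding energy_def by (intro sum_nonneg mult_nonneg_nonneg a_nonneg) auto
  have 1: "2 * h * B \<le> (\<Sum>x\<in>V. \<Sum>y\<in>V. a x y * \<bar>(g x)\<^sup>2 - (g y)\<^sup>2\<bar>)"
    unfolding B_def
  proof (intro coarea_cut_bound)
    fix S assume "S \<subseteq> {x \<in> V. 0 < (g x)\<^sup>2}"
    then show "h * vol S \<le> cut S" using g by (intro iso) (force simp: less_le)
  qed auto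
  also have "\<dots> = (\<Sum>p\<in>V \<times> V. (sqrt (a (fst p) (snd p)) * \<bar>g (fst p) - g (snd p)\<bar>) *
                 (sqrt (a (fst p) (snd p)) * \<bar>g (fst p) + g (snd p)\<bar>))"
  proof -
    have "a x y * \<bar>(g x)\<^sup>2 - (g y)\<^sup>2\<bar> = (sqrt (a x y) * \<bar>g x - g y\<bar>) * (sqrt (a x y) * \<bar>g x + g y\<bar>)" for x y
    proof -
      have "(g x)\<^sup>2 - (g y)\<^sup>2 = (g x - g y) * (g x + g y)" by (simp add: power2_eq_square algebra_simps)
      then show ?thesis using a_nonneg[of x y]
        by (simp add: abs_mult)
    qed
    then show ?thesis by (simp add: sum.cartesian_product split_def)
  qed
  finally have le: "2 * h * B \<le> (\<Sum>p\<in>V \<times> V. (sqrt (a (fst p) (snd p)) * \<bar>g (fst p) - g (snd p)\<bar>) *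
                 (sqrt (a (fst p) (snd p)) * \<bar>g (fst p) + g (snd p)\<bar>))" .
  have "(2 * h * B)\<^sup>2 \<le> (\<Sum>p\<in>V \<times> V. (sqrt (a (fst p) (snd p)) * \<bar>g (fst p) - g (snd p)\<bar>) *
                 (sqrt (a (fst p) (snd p)) * \<bar>g (fst p) + g (snd p)\<bar>))\<^sup>2"
    using le h B0 by (intro power_mono) auto
  also have "\<dots> \<le> (\<Sum>p\<in>V \<times> V. (sqrt (a (fst p) (snd p)) * \<bar>g (fst p) - g (snd p)\<bar>)\<^sup>2) *
                 (\<Sum>p\<in>V \<times> V. (sqrt (a (fst p) (snd p)) * \<bar>g (fst p) + g (snd p)\<bar>)\<^sup>2)"
    by (rule Cauchy_Schwarz_ineq_sum)
  also have "(\<Sum>p\<in>V \<times> V. (sqrt (a (fst p) (snd p)) * \<bar>g (fst p) - g (snd p)\<bar>)\<^sup>2) = energy g"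
    unfolding energy_def by (simp add: sum.cartesian_product split_def power_mult_distrib a_nonneg)
  also have "(\<Sum>p\<in>V \<times> V. (sqrt (a (fst p) (snd p)) * \<bar>g (fst p) + g (snd p)\<bar>)\<^sup>2)
     = (\<Sum>x\<in>V. \<Sum>y\<in>V. a x y * (g x + g y)\<^sup>2)"
    by (simp add: sum.cartesian_product split_def power_mult_distrib a_nonneg)
  also have "energy g * (\<Sum>x\<in>V. \<Sum>y\<in>V. a x y * (g x + g y)\<^sup>2) \<le> energy g * (4 * B)"
  proof (intro mult_left_mono E0)
    have "(\<Sum>x\<in>V. \<Sum>y\<in>V. a x y * (g x + g y)\<^sup>2)
       \<le> (\<Sum>x\<in>V. \<Sum>y\<in>V. 2 * (a x y * (g x)\<^sup>2) + 2 * (a x y * (g y)\<^sup>2))"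
    proof (intro sum_mono)
      fix x y
      have "(g x + g y)\<^sup>2 \<le> 2 * (g x)\<^sup>2 + 2 * (g y)\<^sup>2"
        using zero_le_power2[of "g x - g y"] by (simp add: power2_eq_square algebra_simps)
      then show "a x y * (g x + g y)\<^sup>2 \<le> 2 * (a x y * (g x)\<^sup>2) + 2 * (a x y * (g y)\<^sup>2)"
        using mult_left_mono[OF _ a_nonneg[of x y]] by (fastforce simp: algebra_simps)
    qed
    also have "\<dots> = 4 * B"
      unfolding B_def using sum_a_fst[of "\<lambda>x. (g x)\<^sup>2"] sum_a_snd[of "\<lambda>x. (g x)\<^sup>2"]
      by (simp add: sum.distrib sum_distrib_left[symmetric])
    finally show "(\<Sum>x\<in>V. \<Sum>y\<in>V. a x y * (g x + g y)\<^sup>2) \<le> 4 * B" .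
  qed
  finally have "(h\<^sup>2 * B) * B \<le> energy g * B"
    by (simp add: power2_eq_square algebra_simps)
  then show ?thesis
    using B0 E0 unfolding B_def[symmetric]
    by (cases "B = 0") auto
qed

text \<open>
  Only sets of at most half the volume satisfy a useful isoperimetric inequality. Splitting a
  function at a median makes the supports of its positive and of its negative part such sets.
\<close>

lemma weighted_median_exists:
  fixes f :: "'v \<Rightarrow> real"
  assumes "V \<noteq> {}"
  obtains c where "2 * vol {x \<in> V. c < f x} \<le> vol V" "2 * vol {x \<in> V. f x < c} \<le> vol V"
proof -
  define C where "C = {v \<in> f ` V. 2 * vol {x \<in> V. v < f x} \<le> vol V}"
  have "vol {x \<in> V. Max (f ` V) < f x} = 0"
  proof -
    have "{x \<in> V. Max (f ` V) < f x} = {}" by (auto simp: not_less)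
    then show ?thesis unfolding vol_def by (simp only: sum.empty)
  qed
  moreover have "0 \<le> vol V" unfolding vol_def by (intro sum_nonneg deg_nonneg)
  ultimately have "Max (f ` V) \<in> C"
    unfolding C_def using assms by simp
  then have C: "finite C" "C \<noteq> {}" unfolding C_def by auto
  define c where "c = Min C"
  have cC: "c \<in> C" unfolding c_def using C by (rule Min_in)
  have "2 * vol {x \<in> V. f x < c} \<le> vol V"
  proof (cases "{x \<in> V. f x < c} = {}")
    case True
    then show ?thesis using \<open>0 \<le> vol V\<close> by (simp only:) (simp add: vol_def)
  next
    case False
    define d where "d = Max (f ` {x \<in> V. f x < c})"
    have d: "d \<in> f ` {x \<in> V. f x < c}" unfolding d_def using False by (intro Max_in) auto
    have dle: "f x \<le> d" if "x \<in> V" "f x < c" for x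
      unfolding d_def using that by (intro Max_ge) auto
    \<comment> \<open>\<open>d\<close> is the value of \<open>f\<close> just below \<open>c\<close>, so \<open>f x < c\<close> is the complement of \<open>d < f x\<close>.\<close>
    have "d \<notin> C" using C d unfolding c_def by (metis (no_types, lifting) Min_le imageE leD mem_Collect_eq)
    then have gt: "2 * vol {x \<in> V. d < f x} > vol V" using d unfolding C_def by auto
    have "{x \<in> V. d < f x} = V - {x \<in> V. f x < c}"
      using d dle by force
    then have "vol {x \<in> V. d < f x} = vol V - vol {x \<in> V. f x < c}"
      unfolding vol_def by (simp add: sum_diff)
    then show ?thesis using gt by simp
  qed
  then show ?thesis using cC that unfolding C_def by auto
qed

text \<open>
  Cheeger's inequality: the parts of \<open>f\<close> above and below a median satisfy \<open>cheeger_nonneg\<close>, and their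
  energies add up to at most the energy of \<open>f\<close>, because \<open>p x - p y\<close> and \<open>n x - n y\<close> have opposite
  signs.
\<close>

lemma cheeger_poincare:
  assumes h: "0 \<le> h" and ne: "V \<noteq> {}"
    and iso: "\<And>S. S \<subseteq> V \<Longrightarrow> h * min (vol S) (vol (V - S)) \<le> cut S"
  obtains c where "h\<^sup>2 * (\<Sum>x\<in>V. deg x * (f x - c)\<^sup>2) \<le> energy f"
proof -
  obtain c where c: "2 * vol {x \<in> V. c < f x} \<le> vol V" "2 * vol {x \<in> V. f x < c} \<le> vol V"
    using weighted_median_exists[OF ne] .
  have small: "h * vol S \<le> cut S" if "S \<subseteq> T" "T \<subseteq> V" "2 * vol T \<le> vol V" for S T
  proof -
    have "vol S \<le> vol T" using that by (intro vol_mono)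
    moreover have "vol (V - S) = vol V - vol S"
      unfolding vol_def using that by (intro sum_diff) auto
    ultimately have "min (vol S) (vol (V - S)) = vol S" using that by auto
    then show ?thesis using iso[of S] that by auto
  qed
  define p where "p x = max 0 (f x - c)" for x
  define n where "n x = max 0 (c - f x)" for x
  have P: "h\<^sup>2 * (\<Sum>x\<in>V. deg x * (p x)\<^sup>2) \<le> energy p"
    by (rule cheeger_nonneg[OF h _ small[OF _ _ c(1)]]) (auto simp: p_def)
  have N: "h\<^sup>2 * (\<Sum>x\<in>V. deg x * (n x)\<^sup>2) \<le> energy n"
    by (rule cheeger_nonneg[OF h _ small[OF _ _ c(2)]]) (auto simp: n_def)
  have "energy p + energy n \<le> energy f"
    unfolding energy_def sum.distrib[symmetric]
  proof (intro sum_mono)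
    fix x y
    have "(p x - p y)\<^sup>2 + (n x - n y)\<^sup>2 \<le> ((p x - p y) - (n x - n y))\<^sup>2"
    proof -
      have "(p x - p y) * (n x - n y) \<le> 0"
        unfolding p_def n_def by (auto simp: max_def mult_le_0_iff)
      then show ?thesis by (simp add: power2_eq_square algebra_simps)
    qed
    also have "(p x - p y) - (n x - n y) = f x - f y" unfolding p_def n_def by auto
    finally show "a x y * (p x - p y)\<^sup>2 + a x y * (n x - n y)\<^sup>2 \<le> a x y * (f x - f y)\<^sup>2"
      using mult_left_mono[OF _ a_nonneg[of x y]] by (fastforce simp: algebra_simps)
  qed
  moreover have "(\<Sum>x\<in>V. deg x * (f x - c)\<^sup>2) = (\<Sum>x\<in>V. deg x * (p x)\<^sup>2) + (\<Sum>x\<in>V. deg x * (n x)\<^sup>2)"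
    unfolding sum.distrib[symmetric] p_def n_def
    by (intro sum.cong refl) (auto simp: max_def power2_eq_square algebra_simps)
  ultimately have "h\<^sup>2 * (\<Sum>x\<in>V. deg x * (f x - c)\<^sup>2) \<le> energy f"
    using P N by (simp add: algebra_simps)
  then show ?thesis using that by blast
qed

text \<open>
  The transition operator of the lazy walk, acting on functions.
\<close>

definition lazy_step :: "('v \<Rightarrow> real) \<Rightarrow> 'v \<Rightarrow> real" where
  "lazy_step f x = f x / 2 + (\<Sum>y\<in>V. a x y * f y) / (2 * deg x)"

lemma deg_lazy_step:
  assumes "0 < deg x"
  shows "deg x * lazy_step f x = (deg x * f x + (\<Sum>y\<in>V. a x y * f y)) / 2"
  using assms by (simp add: lazy_step_def field_simps)

lemma lazy_step_mean:
  assumes "\<And>x. x \<in> V \<Longrightarrow> 0 < deg x"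
  shows "(\<Sum>x\<in>V. deg x * lazy_step f x) = (\<Sum>x\<in>V. deg x * f x)"
proof -
  have "(\<Sum>x\<in>V. deg x * lazy_step f x) = (\<Sum>x\<in>V. (deg x * f x + (\<Sum>y\<in>V. a x y * f y)) / 2)"
    by (intro sum.cong refl deg_lazy_step assms)
  also have "\<dots> = (\<Sum>x\<in>V. deg x * f x)"
    using sum_a_snd[of f] by (simp add: sum_divide_distrib[symmetric] sum.distrib)
  finally show ?thesis .
qed

text \<open>
  With \<open>Q\<close> the operator of the non-lazy walk, \<open>lazy_step = (1 + Q) / 2\<close>. Since \<open>Q\<close> is a
  self-adjoint contraction for the inner product weighted by the degrees,
  \<open>\<parallel>f\<parallel>\<^sup>2 - \<parallel>(f + Q f) / 2\<parallel>\<^sup>2\<close> is at least \<open>(\<langle>f, f\<rangle> - \<langle>f, Q f\<rangle>) / 2\<close>, which is a quarter of the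
  energy. Laziness is what allows a bound on the square of the operator without
  information on the negative spectrum of \<open>Q\<close>.
\<close>

lemma lazy_step_energy:
  assumes pos: "\<And>x. x \<in> V \<Longrightarrow> 0 < deg x"
  shows "(\<Sum>x\<in>V. deg x * (lazy_step f x)\<^sup>2) \<le> (\<Sum>x\<in>V. deg x * (f x)\<^sup>2) - energy f / 4"
proof -
  define q where "q x = (\<Sum>y\<in>V. a x y * f y)" for x
  have q2: "(q x)\<^sup>2 / deg x \<le> (\<Sum>y\<in>V. a x y * (f y)\<^sup>2)" if "x \<in> V" for x
  proof -
    have "(q x)\<^sup>2 = (\<Sum>y\<in>V. sqrt (a x y) * (sqrt (a x y) * f y))\<^sup>2"
      unfolding q_def by (simp add: mult.assoc[symmetric] a_nonneg)
    also have "\<dots> \<le> (\<Sum>y\<in>V. (sqrt (a x y))\<^sup>2) * (\<Sum>y\<in>V. (sqrt (a x y) * f y)\<^sup>2)"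
      by (rule Cauchy_Schwarz_ineq_sum)
    also have "\<dots> = deg x * (\<Sum>y\<in>V. a x y * (f y)\<^sup>2)"
      by (simp add: deg_def power_mult_distrib a_nonneg)
    finally show ?thesis using pos[OF that] by (simp add: field_simps)
  qed
  have "(\<Sum>x\<in>V. (q x)\<^sup>2 / deg x) \<le> (\<Sum>x\<in>V. \<Sum>y\<in>V. a x y * (f y)\<^sup>2)"
    by (intro sum_mono q2)
  also have "\<dots> = (\<Sum>x\<in>V. deg x * (f x)\<^sup>2)" by (rule sum_a_snd)
  finally have Q: "(\<Sum>x\<in>V. (q x)\<^sup>2 / deg x) \<le> (\<Sum>x\<in>V. deg x * (f x)\<^sup>2)" .
  have cross: "energy f = 2 * (\<Sum>x\<in>V. deg x * (f x)\<^sup>2) - 2 * (\<Sum>x\<in>V. f x * q x)"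
  proof -
    have "energy f = (\<Sum>x\<in>V. \<Sum>y\<in>V. a x y * (f x)\<^sup>2 + a x y * (f y)\<^sup>2 - 2 * (f x * (a x y * f y)))"
      unfolding energy_def by (intro sum.cong refl) (simp add: power2_eq_square algebra_simps)
    also have "\<dots> = (\<Sum>x\<in>V. deg x * (f x)\<^sup>2) + (\<Sum>x\<in>V. deg x * (f x)\<^sup>2)
        - 2 * (\<Sum>x\<in>V. f x * q x)"
      using sum_a_fst[of "\<lambda>x. (f x)\<^sup>2"] sum_a_snd[of "\<lambda>x. (f x)\<^sup>2"]
      by (simp add: sum.distrib sum_subtractf sum_distrib_left[symmetric] q_def)
    finally show ?thesis by simp
  qed
  have "(\<Sum>x\<in>V. deg x * (lazy_step f x)\<^sup>2)
     = (\<Sum>x\<in>V. deg x * (f x)\<^sup>2 / 4 + f x * q x / 2 + (q x)\<^sup>2 / deg x / 4)"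
  proof (intro sum.cong refl)
    fix x assume "x \<in> V"
    then show "deg x * (lazy_step f x)\<^sup>2 = deg x * (f x)\<^sup>2 / 4 + f x * q x / 2 + (q x)\<^sup>2 / deg x / 4"
      using pos[of x] unfolding lazy_step_def q_def[symmetric] by (simp add: power2_eq_square field_simps)
  qed
  also have "\<dots> = (\<Sum>x\<in>V. deg x * (f x)\<^sup>2) / 4 + (\<Sum>x\<in>V. f x * q x) / 2 + (\<Sum>x\<in>V. (q x)\<^sup>2 / deg x) / 4"
    by (simp add: sum.distrib sum_divide_distrib)
  finally show ?thesis using Q cross by argo
qed

text \<open>
  For a function of mean zero, centring at the mean minimises the weighted square norm, so that the
  constant \<open>c\<close> of Cheeger's inequality may be replaced by \<open>0\<close>.
\<close>

lemma lazy_step_contraction: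
  assumes h: "0 \<le> h" and ne: "V \<noteq> {}" and pos: "\<And>x. x \<in> V \<Longrightarrow> 0 < deg x"
    and iso: "\<And>S. S \<subseteq> V \<Longrightarrow> h * min (vol S) (vol (V - S)) \<le> cut S"
    and mean: "(\<Sum>x\<in>V. deg x * f x) = 0"
  shows "(\<Sum>x\<in>V. deg x * (lazy_step f x)\<^sup>2) \<le> (1 - h\<^sup>2 / 4) * (\<Sum>x\<in>V. deg x * (f x)\<^sup>2)"
proof -
  obtain c where c: "h\<^sup>2 * (\<Sum>x\<in>V. deg x * (f x - c)\<^sup>2) \<le> energy f"
    using cheeger_poincare[OF h ne iso] .
  have "(\<Sum>x\<in>V. deg x * (f x - c)\<^sup>2)
      = (\<Sum>x\<in>V. deg x * (f x)\<^sup>2 + c\<^sup>2 * deg x - 2 * c * (deg x * f x))"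
    by (intro sum.cong refl) (simp add: power2_eq_square algebra_simps)
  also have "\<dots> = (\<Sum>x\<in>V. deg x * (f x)\<^sup>2) + c\<^sup>2 * vol V"
    using mean by (simp add: sum.distrib sum_subtractf sum_distrib_left[symmetric] vol_def)
  finally have "(\<Sum>x\<in>V. deg x * (f x)\<^sup>2) \<le> (\<Sum>x\<in>V. deg x * (f x - c)\<^sup>2)"
    by (simp add: vol_def sum_nonneg deg_nonneg)
  then have "h\<^sup>2 * (\<Sum>x\<in>V. deg x * (f x)\<^sup>2) \<le> energy f"
    using c by (smt (verit) mult_left_mono zero_le_power2)
  then show ?thesis using lazy_step_energy[OF pos, of f] by (simp add: algebra_simps)
qed

lemma lazy_step_iterate:
  assumes h: "0 \<le> h" "h \<le> 1" and ne: "V \<noteq> {}" and pos: "\<And>x. x \<in> V \<Longrightarrow> 0 < deg x"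
    and iso: "\<And>S. S \<subseteq> V \<Longrightarrow> h * min (vol S) (vol (V - S)) \<le> cut S"
    and F: "\<And>n x. x \<in> V \<Longrightarrow> F (Suc n) x = lazy_step (F n) x"
    and mean: "(\<Sum>x\<in>V. deg x * F 0 x) = 0"
  shows "(\<Sum>x\<in>V. deg x * (F n x)\<^sup>2) \<le> (1 - h\<^sup>2 / 4) ^ n * (\<Sum>x\<in>V. deg x * (F 0 x)\<^sup>2)
    \<and> (\<Sum>x\<in>V. deg x * F n x) = 0"
proof (induction n)
  case 0
  then show ?case using mean by simp
next
  case (Suc n)
  have h1: "0 \<le> 1 - h\<^sup>2 / 4" using h power_mono[of h 1 2] by simp
  have "(\<Sum>x\<in>V. deg x * (F (Suc n) x)\<^sup>2) = (\<Sum>x\<in>V. deg x * (lazy_step (F n) x)\<^sup>2)"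
    by (simp add: F)
  also have "\<dots> \<le> (1 - h\<^sup>2 / 4) * (\<Sum>x\<in>V. deg x * (F n x)\<^sup>2)"
    using Suc by (intro lazy_step_contraction[OF h(1) ne pos iso]) auto
  also have "\<dots> \<le> (1 - h\<^sup>2 / 4) * ((1 - h\<^sup>2 / 4) ^ n * (\<Sum>x\<in>V. deg x * (F 0 x)\<^sup>2))"
    using Suc h1 by (intro mult_left_mono) auto
  finally show ?case using Suc lazy_step_mean[OF pos, of "F n"] by (simp add: F)
qed

end

text \<open>
  For fixed \<open>y\<close>, the function \<open>x \<mapsto> P\<^sup>n(x, y) - \<pi>(y)\<close> has mean zero and is obtained by iterating the
  transition operator. Its weighted square norm, for \<open>n = 0\<close> at most the volume and so at most
  \<open>(card V)\<^sup>2\<close>, decays like \<open>(1 - h\<^sup>2 / 4)\<^sup>n\<close>. As degrees are at least one, this bounds every value of the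
  function, by \<open>1 / (4 * card V)\<close> for the given \<open>n\<close>, and summing over \<open>y\<close> costs a factor \<open>card V\<close>.
\<close>

lemma t_mix_le_of_isoperimetry:
  fixes V :: "'v set" and E :: "'v set set"
  defines "D \<equiv> \<lambda>x. real (vertex_degree V E x)"
  assumes fin: "finite V" and ne: "V \<noteq> {}" and noloop: "\<And>x. x \<in> V \<Longrightarrow> {x} \<notin> E"
    and pos: "\<And>x. x \<in> V \<Longrightarrow> 1 \<le> D x"
    and h: "0 < h" "h \<le> 1"
    and iso: "\<And>S. S \<subseteq> V \<Longrightarrow>
       h * min (\<Sum>x\<in>S. D x) (\<Sum>x\<in>V - S. D x) \<le> real (card {(x, y). x \<in> S \<and> y \<in> V - S \<and> {x, y} \<in> E})"
    and n: "8 / h\<^sup>2 * ln (4 * (real (card V))\<^sup>2) \<le> real n"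
  shows "t_mix V E \<le> enat n"
proof -
  define a where "a x y = (if {x, y} \<in> E then 1 else 0::real)" for x y
  interpret network V a
    by standard (auto simp: fin a_def insert_commute)
  define K where "K = real (card V)"
  have K1: "1 \<le> K" unfolding K_def using fin ne by (simp add: Suc_leI card_gt_0_iff)
  have deg: "deg x = D x" for x
    unfolding deg_def a_def D_def vertex_degree_def using fin by (simp add: sum.If_cases Int_def)
  have degpos: "0 < deg x" if "x \<in> V" for x using pos[OF that] deg by simp
  have degle: "deg x \<le> K" for x
    unfolding deg D_def vertex_degree_def K_def using fin by (auto intro!: card_mono)
  have cutE: "cut S = real (card {(x, y). x \<in> S \<and> y \<in> V - S \<and> {x, y} \<in> E})" if "S \<subseteq> V" for S
  proof -
    have fS: "finite S" using that fin by (rule finite_subset)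
    have "cut S = (\<Sum>p\<in>S \<times> (V - S). if {fst p, snd p} \<in> E then 1 else 0)"
      unfolding cut_def a_def using fS by (simp add: sum.cartesian_product split_def)
    also have "\<dots> = real (card (S \<times> (V - S) \<inter> {p. {fst p, snd p} \<in> E}))"
      using fS by (simp add: sum.If_cases)
    also have "S \<times> (V - S) \<inter> {p. {fst p, snd p} \<in> E} = {(x, y). x \<in> S \<and> y \<in> V - S \<and> {x, y} \<in> E}"
      by auto
    finally show ?thesis .
  qed
  have iso': "h * min (vol S) (vol (V - S)) \<le> cut S" if "S \<subseteq> V" for S
    using iso[OF that] cutE[OF that] by (simp add: vol_def deg)
  have vol_pos: "0 < vol V" unfolding vol_def using ne degpos by (intro sum_pos) auto
  have volle: "vol V \<le> K * K"
    unfolding vol_def using sum_bounded_above[of V deg K] degle by (simp add: K_def)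
  have st: "stationary V E y = deg y / vol V" for y
    unfolding stationary_def vol_def by (simp add: deg D_def)
  have stepP: "(\<Sum>z\<in>V. lazy_walk V E x z * f z) = lazy_step f x" if "x \<in> V" for x f
  proof -
    have "(\<Sum>z\<in>V. lazy_walk V E x z * f z) = (\<Sum>z\<in>V. (if z = x then f z / 2 else 0) + a x z * f z / (2 * deg x))"
      using noloop[OF that] by (intro sum.cong refl) (auto simp: lazy_walk_def a_def deg D_def)
    also have "\<dots> = lazy_step f x"
      using that by (simp add: sum.distrib lazy_step_def sum_divide_distrib)
    finally show ?thesis .
  qed
  have step_const: "lazy_step (\<lambda>z. f z - c) x = lazy_step f x - c" if "x \<in> V" for f c x
  proof -
    have "(\<Sum>y\<in>V. a x y * (f y - c)) = (\<Sum>y\<in>V. a x y * f y) - deg x * c"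
      by (simp add: algebra_simps sum_subtractf deg_def sum_distrib_left)
    then have "(\<Sum>y\<in>V. a x y * (f y - c)) / (2 * deg x) = (\<Sum>y\<in>V. a x y * f y) / (2 * deg x) - c / 2"
      using degpos[OF that] by (simp add: diff_divide_distrib)
    then show ?thesis by (simp add: lazy_step_def diff_divide_distrib)
  qed
  define \<rho> where "\<rho> = 1 - h\<^sup>2 / 4"
  have rho: "0 \<le> \<rho>" unfolding \<rho>_def using h power_mono[of h 1 2] by simp
  have ptw: "\<bar>lazy_walk_power V E n x y - stationary V E y\<bar> \<le> 1 / (4 * K)" if x: "x \<in> V" and y: "y \<in> V" for x y
  proof -
    define F where "F k z = lazy_walk_power V E k z y - stationary V E y" for k z
    have FS: "F (Suc k) z = lazy_step (F k) z" if "z \<in> V" for k z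
    proof -
      have "F k = (\<lambda>z. lazy_walk_power V E k z y - stationary V E y)"
        by (simp add: F_def fun_eq_iff)
      then show ?thesis using step_const[OF that] stepP[OF that] by (simp add: F_def)
    qed
    have F0: "(\<Sum>z\<in>V. deg z * F 0 z) = 0"
    proof -
      have "(\<Sum>z\<in>V. deg z * F 0 z) = (\<Sum>z\<in>V. (if z = y then deg z else 0)) - vol V * stationary V E y"
        unfolding F_def vol_def sum_distrib_right sum_subtractf[symmetric]
        by (intro sum.cong refl) (auto simp: algebra_simps)
      then show ?thesis using y vol_pos by (simp add: st)
    qed
    have st01: "0 \<le> stationary V E y" "stationary V E y \<le> 1"
      unfolding st using y vol_pos vol_mono[of "{y}" V] deg_nonneg[of y] by (auto simp: vol_def)
    have F02: "(\<Sum>z\<in>V. deg z * (F 0 z)\<^sup>2) \<le> vol V"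
      unfolding vol_def
    proof (intro sum_mono)
      fix z
      have "\<bar>F 0 z\<bar> \<le> 1" unfolding F_def using st01 by auto
      then have "(F 0 z)\<^sup>2 \<le> 1" by (simp add: abs_square_le_1)
      then show "deg z * (F 0 z)\<^sup>2 \<le> deg z" using mult_left_mono[OF _ deg_nonneg[of z]] by fastforce
    qed
    have "(F n x)\<^sup>2 \<le> deg x * (F n x)\<^sup>2"
      using pos[OF x] by (simp add: deg mult_left_le mult_le_cancel_right1)
    also have "\<dots> \<le> (\<Sum>z\<in>V. deg z * (F n z)\<^sup>2)"
      using x by (intro member_le_sum) (auto simp: deg_nonneg)
    also have "\<dots> \<le> \<rho> ^ n * (\<Sum>z\<in>V. deg z * (F 0 z)\<^sup>2)"
      unfolding \<rho>_def using lazy_step_iterate[of h F n] h ne degpos iso' FS F0 by auto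
    also have "\<dots> \<le> \<rho> ^ n * (K * K)"
      using F02 volle rho by (intro mult_left_mono) auto
    also have "\<rho> ^ n \<le> exp (- h\<^sup>2 / 4) ^ n"
      using rho exp_ge_add_one_self[of "- h\<^sup>2 / 4"] unfolding \<rho>_def by (intro power_mono) auto
    also have "exp (- h\<^sup>2 / 4) ^ n = exp (- (h\<^sup>2 / 4 * n))"
      by (simp add: exp_of_nat_mult[symmetric])
    also have "\<dots> \<le> exp (- (2 * ln (4 * K\<^sup>2)))"
      using n h by (simp add: K_def field_simps)
    also have "\<dots> = 1 / (4 * K\<^sup>2)\<^sup>2"
    proof -
      have "exp (2 * ln (4 * K\<^sup>2)) = (4 * K\<^sup>2)\<^sup>2"
        using K1 exp_of_nat_mult[of 2 "ln (4 * K\<^sup>2)"] by simp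
      then show ?thesis by (simp add: exp_minus field_simps)
    qed
    finally have "(F n x)\<^sup>2 \<le> 1 / (4 * K\<^sup>2)\<^sup>2 * (K * K)"
      using K1 by (simp add: mult_right_mono)
    also have "\<dots> = (1 / (4 * K))\<^sup>2"
      using K1 by (simp add: field_simps power2_eq_square)
    finally show ?thesis using K1
      unfolding F_def by (metis (no_types, lifting) abs_le_square_iff abs_of_nonneg divide_nonneg_nonneg mult_nonneg_nonneg order_trans zero_le_numeral zero_le_one)
  qed
  have "tv_dist V (lazy_walk_power V E n x) (stationary V E) \<le> 1 / 8" if x: "x \<in> V" for x
  proof -
    have "(\<Sum>y\<in>V. \<bar>lazy_walk_power V E n x y - stationary V E y\<bar>) \<le> K * (1 / (4 * K))"
      unfolding K_def using ptw[OF x] K_def by (intro sum_bounded_above) auto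
    then show ?thesis using K1 by (simp add: tv_dist_def)
  qed
  then have "mixing_dist V E n \<le> 1 / 8"
    unfolding mixing_dist_def using ne by (intro cSUP_least) auto
  then have "enat n \<in> enat ` {n. mixing_dist V E n < 1 / 4}" by auto
  then show ?thesis unfolding t_mix_def by (rule Inf_lower)
qed

section \<open>Expected cuts of a kernel with heavy-tailed weights\<close>

text \<open>
  The deterministic input on the weights: \<open>q\<close> stands for the probability of an edge, and \<open>A\<close> for
  the largest possible distance to the power \<open>\<alpha>\<close>, so that the lower bound holds wherever the two vertices lie.
\<close>

locale weighted_vertices =
  fixes T :: "'v set" and w :: "'v \<Rightarrow> real" and q :: "'v \<Rightarrow> 'v \<Rightarrow> real" and A \<theta> :: real
  assumes finite_T [simp]: "finite T" and T_nonempty: "T \<noteq> {}"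
    and w_ge_1: "x \<in> T \<Longrightarrow> 1 \<le> w x"
    and A_ge_1: "1 \<le> A" and \<theta>: "0 < \<theta>" "\<theta> \<le> 1"
    and q_sym: "q x y = q y x"
    and q_lower: "x \<in> T \<Longrightarrow> y \<in> T \<Longrightarrow> min 1 (w x * w y / A) / 2 \<le> q x y"
begin

definition order :: real where "order = real (card T)"
definition profile :: "'v \<Rightarrow> real" where "profile x = order * min 1 ((w x / A) powr \<theta>)"
definition mean_cut :: "'v set \<Rightarrow> real" where "mean_cut S = (\<Sum>x\<in>S. \<Sum>y\<in>T - S. q x y)"

lemma q_nonneg: "x \<in> T \<Longrightarrow> y \<in> T \<Longrightarrow> 0 \<le> q x y"
  using q_lower[of x y] w_ge_1[of x] w_ge_1[of y] A_ge_1
  by (smt (verit, best) divide_nonneg_nonneg half_gt_zero_iff mult_nonneg_nonneg min_def)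

lemma q_half:
  assumes "x \<in> T" "y \<in> T" "A \<le> w x * w y"
  shows "1 / 2 \<le> q x y"
proof -
  have "1 \<le> w x * w y / A" using assms A_ge_1 by simp
  then show ?thesis using q_lower[OF assms(1,2)] by simp
qed

lemma mean_cut_complement:
  assumes "S \<subseteq> T"
  shows "mean_cut (T - S) = mean_cut S"
proof -
  have "T - (T - S) = S" using assms by auto
  then show ?thesis unfolding mean_cut_def by (subst sum.swap) (simp add: q_sym)
qed

lemma mean_cut_ge_rectangle:
  assumes "S \<subseteq> T" "B \<subseteq> S" "C \<subseteq> T - S"
    and "\<And>x y. x \<in> B \<Longrightarrow> y \<in> C \<Longrightarrow> 1 / 2 \<le> q x y"
  shows "real (card B) * real (card C) / 2 \<le> mean_cut S"
proof -
  have fin: "finite S" "finite B" "finite C"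
    using assms by (meson finite_T finite_Diff finite_subset)+
  have "real (card B) * real (card C) / 2 = (\<Sum>x\<in>B. \<Sum>y\<in>C. 1 / 2)" by simp
  also have "\<dots> \<le> (\<Sum>x\<in>B. \<Sum>y\<in>C. q x y)" using assms by (intro sum_mono) auto
  also have "\<dots> \<le> (\<Sum>x\<in>B. \<Sum>y\<in>T - S. q x y)"
    using assms by (intro sum_mono sum_mono2 q_nonneg) auto
  also have "\<dots> \<le> mean_cut S"
    unfolding mean_cut_def using assms fin by (intro sum_mono2 sum_nonneg q_nonneg) auto
  finally show ?thesis .
qed

lemma profile_le_order: "profile x \<le> order"
  unfolding profile_def order_def by (simp add: mult_left_le)

lemma profile_nonneg: "0 \<le> profile x"
  unfolding profile_def order_def by simp

text \<open>
  Since all weights are at least one, \<open>x\<close> is joined to every other vertex with probability at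
  least \<open>min 1 (w x / A) / 2\<close>. If half of the vertices lie outside \<open>S\<close>, they alone give every
  vertex of \<open>S\<close> a quarter of its profile across the cut.
\<close>

lemma mean_cut_isoperimetry_rank_one:
  assumes S: "S \<subseteq> T" and "\<theta> = 1"
  shows "min (sum profile S) (sum profile (T - S)) \<le> 4 * mean_cut S"
proof -
  have *: "sum profile S \<le> 4 * mean_cut S" if S: "S \<subseteq> T" and large: "card T \<le> 2 * card (T - S)" for S
  proof -
    have "profile x / 4 \<le> (\<Sum>y\<in>T - S. q x y)" if x: "x \<in> S" for x
    proof -
      have xT: "x \<in> T" using x S by auto
      have wx: "0 \<le> w x / A" using w_ge_1[OF xT] A_ge_1 by simp
      define c where "c = min 1 (w x / A)"
      have c0: "0 \<le> c" unfolding c_def using wx by simp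
      have "profile x = order * c" unfolding profile_def c_def
        unfolding \<open>\<theta> = 1\<close> powr_one[OF wx] ..
      also have "\<dots> \<le> (2 * real (card (T - S))) * c"
        using large c0 unfolding order_def by (intro mult_right_mono) linarith+
      finally have "profile x / 4 \<le> (\<Sum>y\<in>T - S. c / 2)" by simp
      also have "\<dots> \<le> (\<Sum>y\<in>T - S. q x y)"
      proof (intro sum_mono)
        fix y assume y: "y \<in> T - S"
        have "w x * 1 \<le> w x * w y" using w_ge_1[OF xT] w_ge_1[of y] y by (intro mult_left_mono) auto
        then have "c \<le> min 1 (w x * w y / A)"
          unfolding c_def using A_ge_1 by (auto simp: min_def divide_right_mono intro: order_trans)
        then show "c / 2 \<le> q x y" using q_lower[OF xT, of y] y by auto
      qed
      finally show ?thesis .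
    qed
    then have "(\<Sum>x\<in>S. profile x / 4) \<le> mean_cut S" unfolding mean_cut_def by (rule sum_mono)
    then show ?thesis by (simp add: sum_divide_distrib[symmetric])
  qed
  have "card T = card S + card (T - S)"
    using S by (metis card_Diff_subset card_mono finite_T finite_subset le_add_diff_inverse)
  then consider "card T \<le> 2 * card (T - S)" | "card T \<le> 2 * card (T - (T - S))"
    using S by (metis add_less_mono double_diff linorder_le_cases mult_2 nat_add_left_cancel_le add_le_mono subset_refl)
  then show ?thesis
  proof cases
    case 1
    then show ?thesis using *[OF S] by auto
  next
    case 2
    then show ?thesis using *[of "T - S"] mean_cut_complement[OF S] by auto
  qed
qed

text \<open>
  Weights are sorted into dyadic levels: \<open>hubs i\<close> consists of the vertices which are heavy
  enough to be joined with probability at least one half to every vertex of \<open>heavy i\<close>.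
\<close>

definition heavy :: "nat \<Rightarrow> 'v set" where "heavy i = {x \<in> T. 2 ^ i \<le> w x}"
definition hubs :: "nat \<Rightarrow> 'v set" where "hubs i = {x \<in> T. A / 2 ^ i \<le> w x}"

lemma hubs_mono: "i \<le> k \<Longrightarrow> hubs i \<subseteq> hubs k"
proof -
  assume "i \<le> k"
  then have "A / 2 ^ k \<le> A / 2 ^ i" using A_ge_1 by (intro divide_left_mono) (auto simp: power_increasing)
  then show ?thesis unfolding hubs_def by auto
qed

lemma q_heavy_hubs:
  assumes "x \<in> heavy i" "y \<in> hubs i"
  shows "1 / 2 \<le> q x y"
proof (rule q_half)
  have "A = 2 ^ i * (A / 2 ^ i)" by simp
  also have "\<dots> \<le> w x * w y"
    using assms A_ge_1 w_ge_1[of x] unfolding heavy_def hubs_def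
    by (intro mult_mono) auto
  finally show "A \<le> w x * w y" .
qed (use assms in \<open>auto simp: heavy_def hubs_def\<close>)

lemma finite_heavy [simp]: "finite (heavy i)" and finite_hubs [simp]: "finite (hubs i)"
  by (auto simp: heavy_def hubs_def)

lemma card_split: "finite B \<Longrightarrow> card B = card (B \<inter> S) + card (B - S)"
  by (metis Diff_disjoint Int_Diff_Un Int_commute Int_Diff card_Un_disjoint finite_Diff finite_Int inf_assoc inf_bot_right)

text \<open>
  By the bounds on the sizes of the levels, the profile of a vertex of level \<open>i\<close> is at most a
  multiple of the number of hubs of level \<open>i\<close>, to all of which it is joined with probability at least
  one half. If at every level at least half of the hubs lie outside \<open>S\<close>, then every vertex of \<open>S\<close>
  therefore has a constant proportion of its profile across the cut; the situation is symmetric if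
  at every level half of the hubs lie in \<open>S\<close>. Otherwise the majority changes sides between two
  consecutive levels \<open>j\<close> and \<open>j + 1\<close>. Each vertex of \<open>heavy (j + 1)\<close> is joined to the hubs of both
  levels, so that a proportion of \<open>card (heavy (j + 1)) * card (hubs j)\<close> edges is expected across
  the cut, whichever side these vertices are on. This product is of the same order \<open>order\<^sup>2 * A powr (- \<theta>)\<close>
  for all \<open>j\<close>, and so is the total profile of each single level; hence the cut is comparable, up to
  the number of levels, with the profile of the whole vertex set.
\<close>

lemma mean_cut_isoperimetry_levels:
  assumes S: "S \<subseteq> T"
    and I: "A \<le> 2 ^ I" "\<And>i. i < I \<Longrightarrow> 2 ^ i < A"
    and heavy_lower: "\<And>i. i \<le> I \<Longrightarrow> order * (2 ^ i) powr (- \<theta>) / 4 \<le> card (heavy i)"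
    and heavy_upper: "\<And>i. i \<le> I \<Longrightarrow> card (heavy i) \<le> 4 * (order * (2 ^ i) powr (- \<theta>))"
    and hubs_lower: "\<And>i. i \<le> I \<Longrightarrow> 1 \<le> A / 2 ^ i \<Longrightarrow> order * (A / 2 ^ i) powr (- \<theta>) / 4 \<le> card (hubs i)"
  shows "min (sum profile S) (sum profile (T - S)) \<le> 2048 * real (I + 1) * mean_cut S"
proof -
  \<comment> \<open>Above the top level \<open>I\<close>, where \<open>2 ^ I\<close> reaches \<open>A\<close>, profiles no longer grow.\<close>
  define lev where "lev x = Max {i. i \<le> I \<and> 2 ^ i \<le> w x}" for x
  have order0: "0 \<le> order" by (simp add: order_def)
  have A0: "0 < A" using A_ge_1 by simp
  have lev: "lev x \<le> I" "x \<in> heavy (lev x)" "lev x = I \<or> w x < 2 ^ Suc (lev x)" if x: "x \<in> T" for x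
  proof -
    let ?M = "{i. i \<le> I \<and> 2 ^ i \<le> w x}"
    have fM: "finite ?M" by simp
    moreover have "0 \<in> ?M" using w_ge_1[OF x] by simp
    ultimately have "lev x \<in> ?M" unfolding lev_def by (intro Max_in) auto
    then show "lev x \<le> I" "x \<in> heavy (lev x)" using x by (auto simp: heavy_def)
    have "\<forall>i\<in>?M. i \<le> lev x" unfolding lev_def using Max_ge[OF fM] by blast
    then have "Suc (lev x) \<notin> ?M" by auto
    then show "lev x = I \<or> w x < 2 ^ Suc (lev x)" using \<open>lev x \<le> I\<close> by auto
  qed
  have inv: "(A / 2 ^ i) powr (- \<theta>) = (2 ^ i / A) powr \<theta>" for i
    by (simp add: powr_minus powr_divide)
  have two_th: "(2 * z) powr \<theta> \<le> 2 * z powr \<theta>" if "0 \<le> z" for z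
    using powr_mono[of \<theta> 1 2] \<theta> by (simp add: powr_mult mult_right_mono)
  have profile_hubs: "profile x \<le> 8 * real (card (hubs (lev x)))" if x: "x \<in> T" for x
  proof (cases "1 \<le> A / 2 ^ lev x")
    case True
    have low: "order * (2 ^ lev x / A) powr \<theta> \<le> 4 * card (hubs (lev x))"
      using hubs_lower[OF lev(1)[OF x] True] unfolding inv by simp
    show ?thesis
    proof (cases "w x < 2 ^ Suc (lev x)")
      case True
      have "(w x / A) powr \<theta> \<le> (2 * (2 ^ lev x / A)) powr \<theta>"
        using True A0 w_ge_1[OF x] \<theta> by (intro powr_mono2) (auto simp: divide_right_mono)
      also have "\<dots> \<le> 2 * (2 ^ lev x / A) powr \<theta>" using A0 by (intro two_th) auto
      finally have "profile x \<le> order * (2 * (2 ^ lev x / A) powr \<theta>)"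
        unfolding profile_def using order0 by (intro mult_left_mono) auto
      then show ?thesis using low by simp
    next
      case False
      then have "lev x = I" using lev(3)[OF x] by auto
      then have "1 \<le> (2 ^ lev x / A) powr \<theta>"
        using I(1) A0 \<theta> by (intro ge_one_powr_ge_zero) auto
      then have "order * 1 \<le> order * (2 ^ lev x / A) powr \<theta>" using order0 by (intro mult_left_mono)
      then show ?thesis using low profile_le_order[of x] by simp
    qed
  next
    case False
    have "A / 2 ^ lev x \<le> w y" if "y \<in> T" for y using False w_ge_1[OF that] by linarith
    then have "hubs (lev x) = T" unfolding hubs_def by blast
    then show ?thesis using profile_le_order[of x] by (simp add: order_def)
  qed
  have thin: "sum profile S \<le> 32 * mean_cut S"
    if S: "S \<subseteq> T" and half: "\<And>i. i \<le> I \<Longrightarrow> card (hubs i) \<le> 2 * card (hubs i - S)" for S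
  proof -
    have "profile x / 32 \<le> (\<Sum>y\<in>T - S. q x y)" if x: "x \<in> S" for x
    proof -
      have xT: "x \<in> T" using x S by auto
      have "profile x / 32 \<le> (\<Sum>y\<in>hubs (lev x) - S. 1 / 2)"
        using profile_hubs[OF xT] half[OF lev(1)[OF xT]] by simp
      also have "\<dots> \<le> (\<Sum>y\<in>hubs (lev x) - S. q x y)"
        using lev(2)[OF xT] q_heavy_hubs by (intro sum_mono) auto
      also have "\<dots> \<le> (\<Sum>y\<in>T - S. q x y)"
        using xT by (intro sum_mono2 q_nonneg) (auto simp: hubs_def)
      finally show ?thesis .
    qed
    then have "(\<Sum>x\<in>S. profile x / 32) \<le> mean_cut S" unfolding mean_cut_def by (rule sum_mono)
    then show ?thesis by (simp add: sum_divide_distrib[symmetric])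
  qed
  have mc0: "0 \<le> mean_cut S" unfolding mean_cut_def using S by (intro sum_nonneg q_nonneg) auto
  have scale: "32 * mean_cut S \<le> 2048 * real (I + 1) * mean_cut S"
    using mc0 by (intro mult_right_mono) auto
  consider (out) "\<And>i. i \<le> I \<Longrightarrow> card (hubs i) \<le> 2 * card (hubs i - S)"
    | (ins) "\<And>i. i \<le> I \<Longrightarrow> card (hubs i) \<le> 2 * card (hubs i \<inter> S)"
    | (cross) i k where "i \<le> I" "2 * card (hubs i - S) < card (hubs i)"
        "k \<le> I" "2 * card (hubs k \<inter> S) < card (hubs k)"
    by (meson not_le)
  then show ?thesis
  proof cases
    case out
    then have "sum profile S \<le> 32 * mean_cut S" by (intro thin S)
    then show ?thesis using scale by linarith
  next
    case ins
    have "hubs i - (T - S) = hubs i \<inter> S" for i by (auto simp: hubs_def)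
    then have "sum profile (T - S) \<le> 32 * mean_cut (T - S)" using ins by (intro thin) auto
    then show ?thesis using scale mean_cut_complement[OF S] by linarith
  next
    case cross
    \<comment> \<open>\<open>P i\<close>: the majority of the hubs of level \<open>i\<close> lies in \<open>S\<close>.\<close>
    define P where "P i \<longleftrightarrow> 2 * card (hubs i - S) < card (hubs i)" for i
    have "P i" "\<not> P k" using cross card_split[of "hubs k" S] unfolding P_def by auto
    have "\<exists>j. Suc j \<le> I \<and> P j \<noteq> P (Suc j)"
    proof (rule ccontr)
      assume *: "\<not> ?thesis"
      have "P j = P 0" if "j \<le> I" for j using that
      proof (induction j)
        case (Suc j)
        then show ?case using * by (metis Suc_leD)
      qed simp
      then show False using \<open>P i\<close> \<open>\<not> P k\<close> cross by blast
    qed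
    then obtain j where j: "Suc j \<le> I" "P j \<noteq> P (Suc j)" by blast
    then obtain a b where ab: "a \<in> {j, Suc j}" "b \<in> {j, Suc j}" "P a" "\<not> P b" by blast
    have ha: "card (hubs j) \<le> 2 * card (hubs a \<inter> S)" and hb: "card (hubs j) \<le> 2 * card (hubs b - S)"
    proof -
      have le: "card (hubs j) \<le> card (hubs c)" if "c \<in> {j, Suc j}" for c
        using that hubs_mono[of j c] by (intro card_mono) auto
      show "card (hubs j) \<le> 2 * card (hubs a \<inter> S)" "card (hubs j) \<le> 2 * card (hubs b - S)"
        using ab le[of a] le[of b] card_split[of "hubs a" S] unfolding P_def by auto
    qed
    have sub: "hubs a \<subseteq> hubs (Suc j)" "hubs b \<subseteq> hubs (Suc j)" using ab hubs_mono[of j "Suc j"] by auto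
    \<comment> \<open>At least half of \<open>heavy (Suc j)\<close> lies on one side; its edges to the hubs on the other side cross the cut.\<close>
    have prod: "real (card (heavy (Suc j))) * real (card (hubs j)) \<le> 8 * mean_cut S"
    proof (cases "card (heavy (Suc j)) \<le> 2 * card (heavy (Suc j) \<inter> S)")
      case True
      have "real (card (heavy (Suc j) \<inter> S)) * real (card (hubs b - S)) / 2 \<le> mean_cut S"
        using sub q_heavy_hubs[of _ "Suc j"]
        by (intro mean_cut_ge_rectangle S) (auto simp: hubs_def)
      moreover have "real (card (heavy (Suc j))) * real (card (hubs j))
          \<le> real (2 * card (heavy (Suc j) \<inter> S)) * real (2 * card (hubs b - S))"
        using True hb by (intro mult_mono) auto
      ultimately show ?thesis by simp
    next
      case False
      then have large: "card (heavy (Suc j)) \<le> 2 * card (heavy (Suc j) - S)"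
        using card_split[of "heavy (Suc j)" S] by simp
      have "real (card (hubs a \<inter> S)) * real (card (heavy (Suc j) - S)) / 2 \<le> mean_cut S"
      proof (intro mean_cut_ge_rectangle S)
        fix x y assume "x \<in> hubs a \<inter> S" "y \<in> heavy (Suc j) - S"
        then show "1 / 2 \<le> q x y" using sub q_heavy_hubs[of y "Suc j" x] by (subst q_sym) auto
      qed (auto simp: heavy_def)
      moreover have "real (card (heavy (Suc j))) * real (card (hubs j))
          \<le> real (2 * card (heavy (Suc j) - S)) * real (2 * card (hubs a \<inter> S))"
        using large ha by (intro mult_mono) auto
      ultimately show ?thesis by (simp add: mult.commute)
    qed
    have "order * (2 ^ Suc j) powr (- \<theta>) / 4 * (order * (2 ^ j / A) powr \<theta> / 4)
        \<le> real (card (heavy (Suc j))) * real (card (hubs j))"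
    proof (intro mult_mono heavy_lower j)
      have "1 \<le> A / 2 ^ j" using I(2)[of j] j by (simp add: less_imp_le)
      then show "order * (2 ^ j / A) powr \<theta> / 4 \<le> card (hubs j)"
        using hubs_lower[of j] j unfolding inv by auto
    qed (auto simp: order0)
    also have "order * (2 ^ Suc j) powr (- \<theta>) / 4 * (order * (2 ^ j / A) powr \<theta> / 4)
        = order\<^sup>2 * A powr (- \<theta>) * (2 powr (- \<theta>) / 16)"
    proof -
      have "(2 ^ Suc j) powr (- \<theta>) = 2 powr (- \<theta>) * (2 ^ j) powr (- \<theta>)" by (simp add: powr_mult)
      moreover have "(2 ^ j) powr (- \<theta>) * (2 ^ j / A) powr \<theta> = A powr (- \<theta>)"
        by (simp add: powr_divide powr_minus field_simps)
      ultimately show ?thesis by (simp add: power2_eq_square algebra_simps)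
    qed
    also have "order\<^sup>2 * A powr (- \<theta>) * (1 / 32) \<le> order\<^sup>2 * A powr (- \<theta>) * (2 powr (- \<theta>) / 16)"
    proof (intro mult_left_mono)
      have "(2::real) powr (- 1) \<le> 2 powr (- \<theta>)" using \<theta> by (intro powr_mono) auto
      then show "1 / 32 \<le> 2 powr (- \<theta>) / 16" by (simp add: powr_minus)
    qed auto
    finally have low: "order\<^sup>2 * A powr (- \<theta>) \<le> 256 * mean_cut S" using prod by linarith
    \<comment> \<open>The term \<open>i = lev x\<close> alone dominates the profile of \<open>x\<close>; summing over all levels costs nothing, as each has the same bound.\<close>
    have "sum profile T \<le> (\<Sum>x\<in>T. \<Sum>i\<le>I. of_bool (x \<in> heavy i) * (order * (2 * (2 ^ i / A) powr \<theta>)))"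
    proof (intro sum_mono)
      fix x assume x: "x \<in> T"
      have "profile x \<le> order * (2 * (2 ^ lev x / A) powr \<theta>)"
      proof (cases "w x < 2 ^ Suc (lev x)")
        case True
        have "(w x / A) powr \<theta> \<le> (2 * (2 ^ lev x / A)) powr \<theta>"
          using True A0 w_ge_1[OF x] \<theta> by (intro powr_mono2) (auto simp: divide_right_mono)
        also have "\<dots> \<le> 2 * (2 ^ lev x / A) powr \<theta>" using A0 by (intro two_th) auto
        finally show ?thesis
          unfolding profile_def using order0 by (intro mult_left_mono) auto
      next
        case False
        then have "lev x = I" using lev(3)[OF x] by auto
        then have "1 \<le> (2 ^ lev x / A) powr \<theta>"
          using I(1) A0 \<theta> by (intro ge_one_powr_ge_zero) auto
        then have "order * 1 \<le> order * (2 * (2 ^ lev x / A) powr \<theta>)" using order0 by (intro mult_left_mono) auto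
        then show ?thesis using profile_le_order[of x] by simp
      qed
      also have "\<dots> = of_bool (x \<in> heavy (lev x)) * (order * (2 * (2 ^ lev x / A) powr \<theta>))"
        using lev(2)[OF x] by simp
      also have "\<dots> \<le> (\<Sum>i\<le>I. of_bool (x \<in> heavy i) * (order * (2 * (2 ^ i / A) powr \<theta>)))"
        using lev(1)[OF x] order0 by (intro member_le_sum) auto
      finally show "profile x \<le> (\<Sum>i\<le>I. of_bool (x \<in> heavy i) * (order * (2 * (2 ^ i / A) powr \<theta>)))" .
    qed
    also have "\<dots> = (\<Sum>i\<le>I. real (card (heavy i)) * (order * (2 * (2 ^ i / A) powr \<theta>)))"
    proof -
      have "(\<Sum>x\<in>T. of_bool (x \<in> heavy i)) = real (card (heavy i))" for i
        by (simp add: of_bool_def sum.If_cases heavy_def Int_def)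
      then show ?thesis
        by (subst sum.swap) (simp add: sum_distrib_right[symmetric] del: sum_mult_of_bool_eq sum_of_bool_mult_eq)
    qed
    also have "\<dots> \<le> (\<Sum>i\<le>I. 8 * (order\<^sup>2 * A powr (- \<theta>)))"
    proof (intro sum_mono)
      fix i assume "i \<in> {..I}"
      then have "real (card (heavy i)) * (order * (2 * (2 ^ i / A) powr \<theta>))
         \<le> (4 * (order * (2 ^ i) powr (- \<theta>))) * (order * (2 * (2 ^ i / A) powr \<theta>))"
        using heavy_upper[of i] order0 by (intro mult_right_mono) auto
      also have "\<dots> = 8 * (order\<^sup>2 * A powr (- \<theta>))"
      proof -
        have "(2 ^ i) powr (- \<theta>) * (2 ^ i / A) powr \<theta> = A powr (- \<theta>)"
          by (simp add: powr_divide powr_minus field_simps)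
        then show ?thesis by (simp add: power2_eq_square algebra_simps)
      qed
      finally show "real (card (heavy i)) * (order * (2 * (2 ^ i / A) powr \<theta>)) \<le> 8 * (order\<^sup>2 * A powr (- \<theta>))" .
    qed
    also have "\<dots> = 8 * real (I + 1) * (order\<^sup>2 * A powr (- \<theta>))" by simp
    also have "\<dots> \<le> 8 * real (I + 1) * (256 * mean_cut S)"
      using low by (intro mult_left_mono) auto
    finally have "sum profile T \<le> 2048 * real (I + 1) * mean_cut S" by (simp add: algebra_simps)
    moreover have "sum profile S \<le> sum profile T"
      using S profile_nonneg by (intro sum_mono2) auto
    ultimately show ?thesis by linarith
  qed
qed

end

text \<open>
  The error \<open>4 * card S * l\<close> of the union bound over cuts is absorbed because the profile of \<open>S\<close> is at
  least \<open>\<Gamma> * card S\<close>. It has to be applied to whichever of \<open>S\<close> and its complement has the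
  smaller profile.
\<close>

lemma cut_isoperimetry_of_mean_cut:
  fixes g :: "'v \<Rightarrow> real" and e \<mu> :: "'v set \<Rightarrow> real"
  assumes T: "finite T" and S: "S \<subseteq> T"
    and sym: "e (T - S) = e S" "\<mu> (T - S) = \<mu> S" and e0: "0 \<le> e S"
    and D: "\<And>x. x \<in> T \<Longrightarrow> D x \<le> R * g x"
    and g: "\<And>x. x \<in> T \<Longrightarrow> \<Gamma> \<le> g x" "0 < \<Gamma>"
    and cut: "\<And>S. S \<subseteq> T \<Longrightarrow> S \<noteq> {} \<Longrightarrow> \<mu> S / 4 - 4 * real (card S) * l \<le> e S"
    and mean: "min (sum g S) (sum g (T - S)) \<le> Q * \<mu> S"
    and pos: "0 < Q" "0 < R" "0 \<le> l" and large: "32 * Q * l \<le> \<Gamma>"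
  shows "1 / (8 * Q * R) * min (sum D S) (sum D (T - S)) \<le> e S"
proof -
  have *: "1 / (8 * Q * R) * sum D S' \<le> e S"
    if S': "S' \<subseteq> T" and es: "e S' = e S" "\<mu> S' = \<mu> S" and mu: "sum g S' \<le> Q * \<mu> S" for S'
  proof (cases "S' = {}")
    case True
    then show ?thesis using e0 by simp
  next
    case False
    have "\<Gamma> * real (card S') \<le> sum g S'"
      using sum_bounded_below[of S' \<Gamma> g] g S' by (auto simp: mult.commute)
    then have c: "32 * Q * l * real (card S') \<le> sum g S'"
      using mult_right_mono[OF large, of "real (card S')"] by linarith
    have "sum g S' / (8 * Q) = sum g S' / (4 * Q) - sum g S' / (8 * Q)"
      using pos by (simp add: field_simps)
    also have "\<dots> \<le> \<mu> S / 4 - 4 * real (card S') * l"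
    proof (intro diff_mono)
      show "sum g S' / (4 * Q) \<le> \<mu> S / 4" using mu pos by (simp add: field_simps)
      show "4 * real (card S') * l \<le> sum g S' / (8 * Q)" using c pos by (simp add: field_simps)
    qed
    also have "\<dots> \<le> e S" using cut[OF S' False] es by simp
    finally have 1: "sum g S' / (8 * Q) \<le> e S" .
    have "sum D S' \<le> R * sum g S'"
      unfolding sum_distrib_left using S' D by (intro sum_mono) auto
    then have "1 / (8 * Q * R) * sum D S' \<le> 1 / (8 * Q * R) * (R * sum g S')"
      using pos by (intro mult_left_mono) auto
    also have "\<dots> = sum g S' / (8 * Q)" using pos by simp
    finally show ?thesis using 1 by linarith
  qed
  have pos': "0 \<le> 1 / (8 * Q * R)" using pos by simp
  show ?thesis
  proof (cases "sum g S \<le> sum g (T - S)")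
    case True
    then have "1 / (8 * Q * R) * sum D S \<le> e S" using mean S by (intro *) auto
    then show ?thesis using mult_left_mono[OF min.cobounded1 pos', of "sum D S" "sum D (T - S)"] by linarith
  next
    case False
    then have "1 / (8 * Q * R) * sum D (T - S) \<le> e S" using mean sym by (intro *) auto
    then show ?thesis using mult_left_mono[OF min.cobounded2 pos', of "sum D S" "sum D (T - S)"] by linarith
  qed
qed

section \<open>Elementary estimates\<close>

lemma prod_one_plus_expand:
  fixes f :: "'b \<Rightarrow> real"
  assumes "finite F"
  shows "(\<Prod>z\<in>F. 1 + s * f z) = (\<Sum>J\<in>Pow F. s ^ card J * (\<Prod>z\<in>J. f z))"
proof -
  have "(\<Prod>z\<in>F. 1 + s * f z) = (\<Prod>z\<in>F. s * f z + 1)" by (simp add: add.commute)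
  also have "\<dots> = (\<Sum>J\<in>Pow F. (\<Prod>z\<in>J. s * f z) * (\<Prod>z\<in>F - J. 1))"
    using assms by (rule prod_add)
  finally show ?thesis by (simp add: prod.distrib)
qed

lemma prod_of_bool:
  "finite A \<Longrightarrow> (\<Prod>z\<in>A. of_bool (P z)) = (of_bool (\<forall>z\<in>A. P z) :: real)"
  by (induction A rule: finite_induct) auto

lemma prod_exp_of_bool:
  assumes "finite A"
  shows "(\<Prod>z\<in>A. 1 + c * of_bool (P z)) = (1 + c :: real) ^ card {z \<in> A. P z}"
proof -
  have "(\<Prod>z\<in>A. 1 + c * of_bool (P z)) = (\<Prod>z\<in>A. if P z then 1 + c else 1)"
    by (intro prod.cong) auto
  also have "\<dots> = (1 + c) ^ card {z \<in> A. P z}"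
    using assms by (simp add: prod.If_cases Int_def)
  finally show ?thesis .
qed

lemma two_powr_le_exp: "0 \<le> x \<Longrightarrow> 2 powr x \<le> exp (x::real)"
proof -
  assume "0 \<le> x"
  then have "x * ln 2 \<le> x * 1" using ln_2_less_1 by (intro mult_left_mono) auto
  then show ?thesis by (simp add: powr_def)
qed

context prob_space begin

lemma prob_le_expectation:
  assumes "A \<in> events" "integrable M Y" "AE \<omega> in M. 0 \<le> Y \<omega>" "\<And>\<omega>. \<omega> \<in> A \<Longrightarrow> 1 \<le> Y \<omega>"
  shows "prob A \<le> expectation Y"
proof -
  have "prob A = expectation (indicator A)" using assms(1) by (simp add: sets.Int_space_eq2)
  also have "\<dots> \<le> expectation Y"
  proof (rule integral_mono_AE)
    show "integrable M (indicator A :: _ \<Rightarrow> real)"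
      using assms(1) by (intro integrable_real_indicator) (auto simp: emeasure_eq_measure)
    show "AE \<omega> in M. indicator A \<omega> \<le> Y \<omega>"
      using assms(3) by eventually_elim (auto simp: indicator_def assms(4))
  qed fact
  finally show ?thesis .
qed

end

lemma sum_one_over_power_card:
  assumes "finite T"
  shows "(\<Sum>S\<in>Pow T - {{}}. s ^ card S) = (1 + s :: real) ^ card T - 1"
proof -
  have "(\<Sum>S\<in>Pow T. s ^ card S) = (1 + s) ^ card T"
    using prod_one_plus_expand[OF assms, of s "\<lambda>_. 1"] by simp
  then show ?thesis using assms by (simp add: sum_diff)
qed

lemma exp_minus_one_le_double:
  assumes "0 \<le> x" "x \<le> (1::real)"
  shows "exp x - 1 \<le> 2 * x"
proof -
  have "exp x \<le> 1 + x + x\<^sup>2" using assms by (intro exp_bound) auto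
  moreover have "x\<^sup>2 \<le> x * 1" using assms unfolding power2_eq_square by (intro mult_left_mono) auto
  ultimately show ?thesis by simp
qed

text \<open>
  The computation behind lower tails: with mean \<open>\<mu> = \<Sum>i\<in>I. q i\<close>, the expectation of
  \<open>2 powr (\<mu> / 4 - X)\<close> for a sum \<open>X\<close> of independent indicators is exponentially small in \<open>\<mu>\<close>.
\<close>

lemma exp_minus_half_product:
  assumes "finite I" "\<And>i. i \<in> I \<Longrightarrow> 0 \<le> q i" "\<And>i. i \<in> I \<Longrightarrow> q i \<le> (1::real)"
  shows "2 powr ((\<Sum>i\<in>I. q i) / 4) * (\<Prod>i\<in>I. 1 + (- 1 / 2) * q i) \<le> exp (- ((\<Sum>i\<in>I. q i) / 4))"
proof -
  have "(\<Prod>i\<in>I. 1 + (- 1 / 2) * q i) \<le> (\<Prod>i\<in>I. exp (- q i / 2))"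
  proof (intro prod_mono conjI)
    fix i assume "i \<in> I"
    then show "0 \<le> 1 + (- 1 / 2) * q i" using assms by fastforce
    show "1 + (- 1 / 2) * q i \<le> exp (- q i / 2)"
      using exp_ge_add_one_self[of "- q i / 2"] by simp
  qed
  also have "\<dots> = exp (- ((\<Sum>i\<in>I. q i) / 2))"
    using assms(1) by (simp add: exp_sum[symmetric] sum_negf sum_divide_distrib)
  finally have "2 powr ((\<Sum>i\<in>I. q i) / 4) * (\<Prod>i\<in>I. 1 + (- 1 / 2) * q i)
      \<le> exp ((\<Sum>i\<in>I. q i) / 4) * exp (- ((\<Sum>i\<in>I. q i) / 2))"
  proof (intro mult_mono two_powr_le_exp prod_nonneg)
    show "0 \<le> 1 + (- 1 / 2) * q i" if "i \<in> I" for i using assms(3)[OF that] by simp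
  qed (auto intro!: sum_nonneg assms)
  also have "\<dots> = exp (- ((\<Sum>i\<in>I. q i) / 4))"
    by (simp add: exp_add[symmetric])
  finally show ?thesis .
qed

text \<open>
  The corresponding computation for upper tails, for \<open>2 powr (X - 4 * m)\<close>.
\<close>

lemma exp_one_plus_product:
  assumes "finite I" "\<And>i. i \<in> I \<Longrightarrow> 0 \<le> q i" "(\<Sum>i\<in>I. q i) \<le> (m::real)"
  shows "2 powr (- (4 * m)) * (\<Prod>i\<in>I. 1 + q i) \<le> exp (- m)"
proof -
  have m0: "0 \<le> m" using assms sum_nonneg[of I q] by auto
  have "(\<Prod>i\<in>I. 1 + q i) \<le> (\<Prod>i\<in>I. exp (q i))"
    using assms by (intro prod_mono) (auto simp: add_nonneg_nonneg)
  also have "\<dots> \<le> exp m" using assms by (simp add: exp_sum[symmetric])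
  finally have "2 powr (- (4 * m)) * (\<Prod>i\<in>I. 1 + q i) \<le> 2 powr (- (4 * m)) * exp m"
    by (intro mult_left_mono) auto
  also have "\<dots> = exp (m - 4 * m * ln 2)" by (simp add: powr_def exp_add[symmetric])
  also have "\<dots> \<le> exp (- m)"
  proof -
    have "m * (1/2) \<le> m * ln 2" using m0 ln2_ge_two_thirds by (intro mult_left_mono) auto
    then show ?thesis by simp
  qed
  finally show ?thesis .
qed

text \<open>
  The lower truncation at \<open>0\<close> keeps the function bounded on the null set of negative weights.
\<close>

definition clamp :: "real \<Rightarrow> real" where "clamp z = max 0 (min 1 z)"

lemma clamp_bounds: "0 \<le> clamp z" "clamp z \<le> 1" by (auto simp: clamp_def)

text \<open>
  Bounding \<open>min 1 z\<close> by dyadic indicators reduces its expectation to tail probabilities of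
  the weight.
\<close>

lemma clamp_dyadic:
  "clamp z \<le> (\<Sum>k<K. (1/2) ^ k * of_bool ((1/2) ^ Suc k \<le> z)) + (1/2) ^ K"
proof (induction K)
  case 0
  then show ?case by (simp add: clamp_bounds)
next
  case (Suc K)
  let ?s = "\<Sum>k<K. (1/2) ^ k * of_bool ((1/2) ^ Suc k \<le> z) :: real"
  have "0 \<le> ?s" by (intro sum_nonneg) auto
  show ?case
  proof (cases "(1/2) ^ Suc K \<le> z")
    case True
    then have "(1/2) ^ K * of_bool ((1/2) ^ Suc K \<le> z) = ((1/2) ^ K :: real)" by simp
    moreover have "0 < ((1/2) ^ Suc K :: real)" by simp
    ultimately show ?thesis using Suc unfolding sum.lessThan_Suc by linarith
  next
    case False
    moreover have "0 < ((1/2) ^ Suc K :: real)" by simp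
    ultimately have "clamp z \<le> (1/2) ^ Suc K" unfolding clamp_def by linarith
    then show ?thesis using \<open>0 \<le> ?s\<close> False by simp
  qed
qed

lemma torus_dist_bounds:
  assumes "x \<in> torus N" "y \<in> torus N" "x \<noteq> y"
  shows "1 \<le> torus_dist N x y" "torus_dist N x y \<le> real N"
  using assms by (auto simp: torus_dist_def torus_def min_def abs_if)

lemma harm_le_one_plus_ln: "0 < n \<Longrightarrow> harm n \<le> 1 + ln (real n)"
proof (induction n)
  case (Suc n)
  show ?case
  proof (cases "n = 0")
    case False
    then have n: "0 < n" by simp
    have "ln (real n / real (Suc n)) \<le> real n / real (Suc n) - 1"
      using n by (intro ln_le_minus_one) auto
    also have "\<dots> = - inverse (real (Suc n))" by (simp add: field_simps)
    finally have "inverse (real (Suc n)) \<le> ln (real (Suc n)) - ln (real n)"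
      using n by (simp add: ln_div)
    then show ?thesis using Suc.IH[OF n] by (simp add: harm_Suc)
  qed (simp add: harm_def)
qed simp

text \<open>
  The two terms of the minimum in the distance are summed separately, on either side of \<open>x\<close>; this
  makes four harmonic sums.
\<close>

lemma sum_inverse_torus_dist:
  assumes x: "x \<in> torus N"
  shows "(\<Sum>y\<in>torus N - {x}. 1 / torus_dist N x y) \<le> 4 * (1 + ln (real N))"
proof -
  have N: "0 < N" using x by (auto simp: torus_def)
  have fin: "finite (torus N)" by (simp add: torus_def)
  have aux: "(\<Sum>y\<in>A. 1 / real (f y)) \<le> 1 + ln (real N)"
    if "inj_on f A" "f ` A \<subseteq> {1..N}" for f :: "nat \<Rightarrow> nat" and A
  proof -
    have "(\<Sum>y\<in>A. 1 / real (f y)) = (\<Sum>k\<in>f ` A. 1 / real k)"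
      using that(1) by (simp add: sum.reindex)
    also have "\<dots> \<le> (\<Sum>k\<in>{1..N}. 1 / real k)"
      using that(2) by (intro sum_mono2) auto
    also have "\<dots> = harm N" by (simp add: harm_def inverse_eq_divide)
    finally show ?thesis using harm_le_one_plus_ln[OF N] by linarith
  qed
  let ?A = "{y \<in> torus N. y < x}" and ?B = "{y \<in> torus N. x < y}"
  have split: "torus N - {x} = ?A \<union> ?B" by auto
  have pt: "1 / torus_dist N x y \<le> 1 / a + 1 / b"
    if "torus_dist N x y = min a b" "0 < a" "0 < b" for a b y
    using that by (auto simp: min_def)
  have A: "(\<Sum>y\<in>?A. 1 / torus_dist N x y) \<le> (\<Sum>y\<in>?A. 1 / real (x - y)) + (\<Sum>y\<in>?A. 1 / real (N - x + y))"
    unfolding sum.distrib[symmetric]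
  proof (intro sum_mono pt)
    fix y assume "y \<in> ?A"
    then show "torus_dist N x y = min (real (x - y)) (real (N - x + y))"
      "0 < real (x - y)" "0 < real (N - x + y)"
      using x by (auto simp: torus_dist_def torus_def of_nat_diff)
  qed
  have B: "(\<Sum>y\<in>?B. 1 / torus_dist N x y) \<le> (\<Sum>y\<in>?B. 1 / real (y - x)) + (\<Sum>y\<in>?B. 1 / real (N - y + x))"
    unfolding sum.distrib[symmetric]
  proof (intro sum_mono pt)
    fix y assume "y \<in> ?B"
    then show "torus_dist N x y = min (real (y - x)) (real (N - y + x))"
      "0 < real (y - x)" "0 < real (N - y + x)"
      using x by (auto simp: torus_dist_def torus_def of_nat_diff)
  qed
  have "(\<Sum>y\<in>torus N - {x}. 1 / torus_dist N x y)
      = (\<Sum>y\<in>?A. 1 / torus_dist N x y) + (\<Sum>y\<in>?B. 1 / torus_dist N x y)"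
    unfolding split using fin by (intro sum.union_disjoint) auto
  moreover have "(\<Sum>y\<in>?A. 1 / real (x - y)) \<le> 1 + ln (real N)"
    using x by (intro aux) (auto simp: inj_on_def torus_def)
  moreover have "(\<Sum>y\<in>?A. 1 / real (N - x + y)) \<le> 1 + ln (real N)"
    using x by (intro aux) (auto simp: inj_on_def torus_def)
  moreover have "(\<Sum>y\<in>?B. 1 / real (y - x)) \<le> 1 + ln (real N)"
    using x by (intro aux) (auto simp: inj_on_def torus_def)
  moreover have "(\<Sum>y\<in>?B. 1 / real (N - y + x)) \<le> 1 + ln (real N)"
    using x by (intro aux) (auto simp: inj_on_def torus_def)
  ultimately show ?thesis using A B by argo
qed

lemma half_min_le_one_minus_exp:
  assumes "0 \<le> (z::real)"
  shows "min 1 z / 2 \<le> 1 - exp (- z)"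
proof -
  define m where "m = min 1 z"
  have m: "0 \<le> m" "m \<le> 1" "m \<le> z" using assms by (auto simp: m_def)
  have "1 \<le> (1 - m / 2) * (1 + m)"
  proof -
    have "m * m \<le> m * 1" using m by (intro mult_left_mono) auto
    then show ?thesis by (simp add: field_simps)
  qed
  also have "\<dots> \<le> (1 - m / 2) * exp m"
    using m exp_ge_add_one_self[of m] by (intro mult_left_mono) auto
  finally have "exp (- m) \<le> 1 - m / 2" by (simp add: exp_minus field_simps)
  moreover have "exp (- z) \<le> exp (- m)" using m by simp
  ultimately show ?thesis unfolding m_def by linarith
qed

definition dyadic_ceiling :: "real \<Rightarrow> nat" where
  "dyadic_ceiling z = (LEAST i. z \<le> 2 ^ i)"

lemma dyadic_ceiling: "z \<le> 2 ^ dyadic_ceiling z"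
proof -
  obtain i :: nat where "z < 2 ^ i" using real_arch_pow[of 2 z] by auto
  then show ?thesis unfolding dyadic_ceiling_def by (intro LeastI[of "\<lambda>i. z \<le> 2 ^ i" i]) auto
qed

lemma less_dyadic_ceiling: "i < dyadic_ceiling z \<Longrightarrow> 2 ^ i < z"
  unfolding dyadic_ceiling_def using not_less_Least by force

lemma dyadic_ceiling_le: "z \<le> 2 ^ i \<Longrightarrow> dyadic_ceiling z \<le> i"
  unfolding dyadic_ceiling_def by (rule Least_le)

lemma power_dyadic_ceiling_le:
  assumes "1 \<le> z"
  shows "2 ^ dyadic_ceiling z \<le> 2 * z"
proof (cases "dyadic_ceiling z")
  case (Suc i)
  then show ?thesis using less_dyadic_ceiling[of i z] by simp
qed (use assms in auto)

lemma dyadic_ceiling_le_log: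
  assumes "1 \<le> z"
  shows "real (dyadic_ceiling z) \<le> log 2 z + 1"
proof -
  have "log 2 (2 ^ dyadic_ceiling z) \<le> log 2 (2 * z)"
    using assms power_dyadic_ceiling_le[OF assms] by (intro log_mono) auto
  then show ?thesis using assms by (simp add: log_mult)
qed

lemma card_cycle_neighbours:
  "card {y \<in> torus N. {x, y} \<in> cycle_edges N} \<le> 2"
proof -
  have "{y \<in> torus N. {x, y} \<in> cycle_edges N} \<subseteq> {x mod N + 1, if x = 1 then N else x - 1}"
  proof
    fix y assume "y \<in> {y \<in> torus N. {x, y} \<in> cycle_edges N}"
    then obtain z where yT: "y \<in> torus N" and z: "{x, y} = {z, z mod N + 1}"
      unfolding cycle_edges_def by blast
    then consider "y = x mod N + 1" | "x = y mod N + 1" by (auto simp: doubleton_eq_iff)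
    then show "y \<in> {x mod N + 1, if x = 1 then N else x - 1}"
    proof cases
      case 2
      then show ?thesis using yT by (cases "y = N") (auto simp: torus_def)
    qed simp
  qed
  then have "card {y \<in> torus N. {x, y} \<in> cycle_edges N} \<le> card {x mod N + 1, if x = 1 then N else x - 1}"
    by (intro card_mono) auto
  also have "\<dots> \<le> 2" by (simp add: card_insert_if)
  finally show ?thesis .
qed

lemma successor_neighbour:
  assumes "x \<in> torus N" "2 \<le> N"
  shows "x mod N + 1 \<in> torus N" "x mod N + 1 \<noteq> x" "{x, x mod N + 1} \<in> cycle_edges N"
proof -
  show 1: "x mod N + 1 \<in> torus N" using assms by (auto simp: torus_def Suc_le_eq)
  show 2: "x mod N + 1 \<noteq> x" using assms by (cases "x = N") (auto simp: torus_def)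
  show "{x, x mod N + 1} \<in> cycle_edges N"
    unfolding cycle_edges_def torus_pairs_def using assms(1) 1 2 by blast
qed

section \<open>Exponential moments given the weights\<close>

context scale_free_percolation begin

definition edge_prob :: "'a \<Rightarrow> nat \<Rightarrow> nat \<Rightarrow> real" where
  "edge_prob \<omega> x y = 1 - exp (- (W x \<omega> * W y \<omega>) / torus_dist N x y powr \<alpha>)"

definition weight_algebra :: "'a measure" where
  "weight_algebra = vimage_algebra (space M) (\<lambda>\<omega>. \<lambda>x\<in>torus N. W x \<omega>) (PiM (torus N) (\<lambda>_. borel))"

lemma finite_torus [simp]: "finite (torus N)" by (simp add: torus_def)

lemma edge_prob_commute: "edge_prob \<omega> x y = edge_prob \<omega> y x"
  by (simp add: edge_prob_def torus_dist_def abs_minus_commute mult.commute)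

lemma edge_prob_le_1: "edge_prob \<omega> x y \<le> 1"
  by (simp add: edge_prob_def)

lemma W_measurable: "x \<in> torus N \<Longrightarrow> W x \<in> borel_measurable M"
  using weights_indep by (auto simp: indep_vars_def)

lemma subalgebra_weight_algebra: "subalgebra M weight_algebra"
proof -
  have "(\<lambda>\<omega>. \<lambda>x\<in>torus N. W x \<omega>) \<in> measurable M (PiM (torus N) (\<lambda>_. borel))"
    by (intro measurable_restrict W_measurable)
  then show ?thesis
    unfolding subalgebra_def weight_algebra_def measurable_iff_sets by simp
qed

lemma W_measurable_weight_algebra:
  assumes "x \<in> torus N"
  shows "W x \<in> borel_measurable weight_algebra"
proof -
  have "(\<lambda>\<omega>. \<lambda>x\<in>torus N. W x \<omega>) \<in> measurable weight_algebra (PiM (torus N) (\<lambda>_. borel))"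
    unfolding weight_algebra_def
    by (rule measurable_vimage_algebra1) (auto simp: space_PiM)
  then have "(\<lambda>\<omega>. (\<lambda>x\<in>torus N. W x \<omega>) x) \<in> borel_measurable weight_algebra"
    using measurable_component_singleton[OF assms, of "\<lambda>_. borel"] by (rule measurable_compose)
  then show ?thesis using assms by simp
qed

lemma edge_prob_measurable_weight_algebra:
  assumes "x \<in> torus N" "y \<in> torus N"
  shows "(\<lambda>\<omega>. edge_prob \<omega> x y) \<in> borel_measurable weight_algebra"
  using W_measurable_weight_algebra[OF assms(1)] W_measurable_weight_algebra[OF assms(2)]
  unfolding edge_prob_def by measurable

lemma edge_prob_measurable:
  assumes "x \<in> torus N" "y \<in> torus N"
  shows "(\<lambda>\<omega>. edge_prob \<omega> x y) \<in> borel_measurable M"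
  by (rule measurable_from_subalg[OF subalgebra_weight_algebra edge_prob_measurable_weight_algebra[OF assms]])

lemma edge_indicator_measurable:
  assumes "x \<in> torus N" "y \<in> torus N"
  shows "(\<lambda>\<omega>. of_bool ({x, y} \<in> G \<omega>) :: real) \<in> borel_measurable M"
proof -
  have "{\<omega> \<in> space M. {x, y} \<in> G \<omega>} \<in> events" using assms by (rule edges_measurable)
  then have "(indicator {\<omega> \<in> space M. {x, y} \<in> G \<omega>} :: 'a \<Rightarrow> real) \<in> borel_measurable M"
    by (rule borel_measurable_indicator)
  moreover have "of_bool ({x, y} \<in> G \<omega>) = (indicator {\<omega> \<in> space M. {x, y} \<in> G \<omega>} \<omega> :: real)"
    if "\<omega> \<in> space M" for \<omega> using that by (simp add: indicator_def)
  ultimately show ?thesis by (subst measurable_cong)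
qed

text \<open>
  The pairs whose edge is random; edges of the cycle are always present.
\<close>

definition free_pairs :: "(nat \<times> nat) set" where
  "free_pairs = {(x, y). x \<in> torus N \<and> y \<in> torus N \<and> x < y \<and> {x, y} \<notin> cycle_edges N}"

text \<open>
  The defining property of the conditional expectation, integrated against a bounded function \<open>g\<close> of
  the weights. Working with such integrals avoids conditional probabilities of all further events.
\<close>

lemma free_pairs_joint:
  assumes J: "J \<subseteq> free_pairs" and g: "g \<in> borel_measurable weight_algebra" "\<And>\<omega>. \<omega> \<in> space M \<Longrightarrow> \<bar>g \<omega>\<bar> \<le> C"
  shows "integrable M (\<lambda>\<omega>. g \<omega> * (\<Prod>(x, y)\<in>J. of_bool ({x, y} \<in> G \<omega>)))" (is ?i1)
    and "integrable M (\<lambda>\<omega>. g \<omega> * (\<Prod>(x, y)\<in>J. edge_prob \<omega> x y))" (is ?i2)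
    and "(\<integral>\<omega>. g \<omega> * (\<Prod>(x, y)\<in>J. of_bool ({x, y} \<in> G \<omega>)) \<partial>M) = (\<integral>\<omega>. g \<omega> * (\<Prod>(x, y)\<in>J. edge_prob \<omega> x y) \<partial>M)" (is ?eq)
proof -
  interpret sub: finite_measure_subalgebra M weight_algebra
    by standard (rule subalgebra_weight_algebra)
  have fJ: "finite J"
    by (rule finite_subset[OF J], rule finite_subset[of _ "torus N \<times> torus N"]) (auto simp: free_pairs_def)
  have JT: "x \<in> torus N" "y \<in> torus N" if "(x, y) \<in> J" for x y using that J by (auto simp: free_pairs_def)
  let ?X = "{\<omega> \<in> space M. \<forall>(x, y)\<in>J. {x, y} \<in> G \<omega>}"
  let ?e = "\<lambda>\<omega>. \<Prod>(x, y)\<in>J. of_bool ({x, y} \<in> G \<omega>) :: real"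
  have e: "?e \<omega> = indicator ?X \<omega>" if "\<omega> \<in> space M" for \<omega>
    using that fJ by (simp add: split_def prod_of_bool indicator_def)
  have gM: "g \<in> borel_measurable M" by (rule measurable_from_subalg[OF subalgebra_weight_algebra g(1)])
  have eM: "?e \<in> borel_measurable M"
    unfolding split_def using JT by (intro borel_measurable_prod edge_indicator_measurable) auto
  have XM: "(indicator ?X :: _ \<Rightarrow> real) \<in> borel_measurable M"
    by (rule measurable_cong[THEN iffD1, OF _ eM]) (rule e)
  have i0: "integrable M (\<lambda>\<omega>. g \<omega> * indicator ?X \<omega>)"
  proof (rule integrable_const_bound[where B = C])
    show "AE \<omega> in M. norm (g \<omega> * indicator ?X \<omega>) \<le> C"
    proof (rule AE_I2)
      fix \<omega> assume "\<omega> \<in> space M"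
      then show "norm (g \<omega> * indicator ?X \<omega>) \<le> C"
        using g(2)[of \<omega>] by (auto simp: indicator_def abs_mult)
    qed
  qed (intro borel_measurable_times gM XM)
  have "AE \<omega> in M. real_cond_exp M weight_algebra (indicator ?X) \<omega> = (\<Prod>(x, y)\<in>J. edge_prob \<omega> x y)"
    using edges_cond_indep[of J] J unfolding free_pairs_def weight_algebra_def edge_prob_def by simp
  then have ae: "AE \<omega> in M. g \<omega> * real_cond_exp M weight_algebra (indicator ?X) \<omega> = g \<omega> * (\<Prod>(x, y)\<in>J. edge_prob \<omega> x y)"
    by eventually_elim simp
  have pM: "(\<lambda>\<omega>. g \<omega> * (\<Prod>(x, y)\<in>J. edge_prob \<omega> x y)) \<in> borel_measurable M"
    using gM JT unfolding split_def by (intro borel_measurable_times borel_measurable_prod edge_prob_measurable) auto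
  have cM: "(\<lambda>\<omega>. g \<omega> * real_cond_exp M weight_algebra (indicator ?X) \<omega>) \<in> borel_measurable M"
    using sub.real_cond_exp_intg(1)[OF i0 g(1) XM] by auto
  show ?i1
    by (rule Bochner_Integration.integrable_cong[THEN iffD1, OF refl _ i0]) (simp add: e)
  show ?i2
    using sub.real_cond_exp_intg(1)[OF i0 g(1) XM] integrable_cong_AE[OF cM pM ae] by simp
  have "(\<integral>\<omega>. g \<omega> * ?e \<omega> \<partial>M) = (\<integral>\<omega>. g \<omega> * indicator ?X \<omega> \<partial>M)"
    by (rule Bochner_Integration.integral_cong) (simp_all add: e)
  also have "\<dots> = (\<integral>\<omega>. g \<omega> * real_cond_exp M weight_algebra (indicator ?X) \<omega> \<partial>M)"
    using sub.real_cond_exp_intg(2)[OF i0 g(1) XM] by simp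
  also have "\<dots> = (\<integral>\<omega>. g \<omega> * (\<Prod>(x, y)\<in>J. edge_prob \<omega> x y) \<partial>M)"
    by (rule integral_cong_AE[OF cM pM ae])
  finally show ?eq .
qed

lemma free_pairs_generating_function:
  assumes F: "F \<subseteq> free_pairs" and g: "g \<in> borel_measurable weight_algebra" "\<And>\<omega>. \<omega> \<in> space M \<Longrightarrow> \<bar>g \<omega>\<bar> \<le> C"
  shows "integrable M (\<lambda>\<omega>. g \<omega> * (\<Prod>(x, y)\<in>F. 1 + s * of_bool ({x, y} \<in> G \<omega>)))" (is ?i1)
    and "integrable M (\<lambda>\<omega>. g \<omega> * (\<Prod>(x, y)\<in>F. 1 + s * edge_prob \<omega> x y))" (is ?i2)
    and "(\<integral>\<omega>. g \<omega> * (\<Prod>(x, y)\<in>F. 1 + s * of_bool ({x, y} \<in> G \<omega>)) \<partial>M) =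
         (\<integral>\<omega>. g \<omega> * (\<Prod>(x, y)\<in>F. 1 + s * edge_prob \<omega> x y) \<partial>M)" (is ?eq)
proof -
  have fF: "finite F"
    by (rule finite_subset[OF F], rule finite_subset[of _ "torus N \<times> torus N"]) (auto simp: free_pairs_def)
  have expand: "g \<omega> * (\<Prod>(x, y)\<in>F. 1 + s * f x y) = (\<Sum>J\<in>Pow F. s ^ card J * (g \<omega> * (\<Prod>(x, y)\<in>J. f x y)))"
    for \<omega> and f :: "nat \<Rightarrow> nat \<Rightarrow> real"
    using prod_one_plus_expand[OF fF, of s "\<lambda>z. f (fst z) (snd z)"]
    by (simp add: split_def sum_distrib_left algebra_simps)
  have J: "J \<subseteq> free_pairs" if "J \<in> Pow F" for J using that F by auto
  note joint = free_pairs_joint[OF J g]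
  show ?i1 unfolding expand by (intro Bochner_Integration.integrable_sum integrable_mult_right joint)
  show ?i2 unfolding expand by (intro Bochner_Integration.integrable_sum integrable_mult_right joint)
  show ?eq
    unfolding expand
    by (subst (1 2) Bochner_Integration.integral_sum)
       (auto intro!: integrable_mult_right joint sum.cong simp: joint(3))
qed

text \<open>
  For a set \<open>S\<close>, the pairs from \<open>S\<close> to its complement are distinct as unordered pairs, so they may be
  listed with the endpoint in \<open>S\<close> first. The case of a single vertex describes its degree.
\<close>

lemma boundary_generating_function:
  assumes S: "S \<subseteq> torus N"
    and I: "I \<subseteq> {(x, y). x \<in> S \<and> y \<in> torus N - S \<and> {x, y} \<notin> cycle_edges N}"
    and g: "g \<in> borel_measurable weight_algebra" "\<And>\<omega>. \<omega> \<in> space M \<Longrightarrow> \<bar>g \<omega>\<bar> \<le> C"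
  shows "integrable M (\<lambda>\<omega>. g \<omega> * (\<Prod>(x, y)\<in>I. 1 + s * of_bool ({x, y} \<in> G \<omega>)))" (is ?i1)
    and "integrable M (\<lambda>\<omega>. g \<omega> * (\<Prod>(x, y)\<in>I. 1 + s * edge_prob \<omega> x y))" (is ?i2)
    and "(\<integral>\<omega>. g \<omega> * (\<Prod>(x, y)\<in>I. 1 + s * of_bool ({x, y} \<in> G \<omega>)) \<partial>M) =
         (\<integral>\<omega>. g \<omega> * (\<Prod>(x, y)\<in>I. 1 + s * edge_prob \<omega> x y) \<partial>M)" (is ?eq)
proof -
  let ?o = "\<lambda>(x, y). (min x y, max x y) :: nat \<times> nat"
  have inj: "inj_on ?o I"
  proof (rule inj_onI, clarify)
    fix x y x' y'
    assume xy: "(x, y) \<in> I" "(x', y') \<in> I" and eq: "min x y = min x' y'" "max x y = max x' y'"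
    have "{x, y} = {min x y, max x y}" "{x', y'} = {min x' y', max x' y'}"
      by (auto simp: min_def max_def)
    then have "{x, y} = {x', y'}" using eq by simp
    moreover have "x \<in> S" "y \<notin> S" "x' \<in> S" "y' \<notin> S" using xy I by auto
    ultimately show "x = x' \<and> y = y'" by (metis doubleton_eq_iff)
  qed
  have F: "?o ` I \<subseteq> free_pairs"
  proof
    fix z assume "z \<in> ?o ` I"
    then obtain x y where xy: "(x, y) \<in> I" "z = (min x y, max x y)" by auto
    then have "x \<in> torus N" "y \<in> torus N" "x \<noteq> y" "{x, y} \<notin> cycle_edges N" using I S by auto
    moreover have "{min x y, max x y} = {x, y}" by (auto simp: min_def max_def)
    ultimately show "z \<in> free_pairs" unfolding free_pairs_def xy(2) by (auto simp: min_def max_def)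
  qed
  have reindex: "(\<Prod>(x, y)\<in>?o ` I. f x y) = (\<Prod>(x, y)\<in>I. f x y)"
    if "\<And>x y. f x y = f y x" for f :: "nat \<Rightarrow> nat \<Rightarrow> real"
    using that by (subst prod.reindex[OF inj]) (auto intro!: prod.cong simp: min_def max_def)
  have 1: "(\<Prod>(x, y)\<in>?o ` I. 1 + s * of_bool ({x, y} \<in> G \<omega>)) = (\<Prod>(x, y)\<in>I. 1 + s * of_bool ({x, y} \<in> G \<omega>))" for \<omega>
    by (rule reindex) (simp add: insert_commute)
  have 2: "(\<Prod>(x, y)\<in>?o ` I. 1 + s * edge_prob \<omega> x y) = (\<Prod>(x, y)\<in>I. 1 + s * edge_prob \<omega> x y)" for \<omega>
    by (rule reindex) (simp add: edge_prob_commute)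
  note gf = free_pairs_generating_function[OF F g, where s = s]
  show ?i1 using gf(1) unfolding 1 .
  show ?i2 using gf(2) unfolding 2 .
  show ?eq using gf(3) unfolding 1 2 .
qed

lemma weights_product:
  assumes A: "A \<subseteq> torus N" and h: "\<And>y. y \<in> A \<Longrightarrow> h y \<in> borel_measurable borel"
    and b: "\<And>y z. y \<in> A \<Longrightarrow> \<bar>h y z\<bar> \<le> (C::real)"
  shows "integrable M (\<lambda>\<omega>. \<Prod>y\<in>A. h y (W y \<omega>))"
    and "(\<integral>\<omega>. (\<Prod>y\<in>A. h y (W y \<omega>)) \<partial>M) = (\<Prod>y\<in>A. \<integral>\<omega>. h y (W y \<omega>) \<partial>M)"
proof -
  have fA: "finite A" using A by (rule finite_subset) simp
  have "indep_vars (\<lambda>_. borel) W A" using weights_indep A by (rule indep_vars_subset)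
  then have ind: "indep_vars (\<lambda>_. borel) (\<lambda>y \<omega>. h y (W y \<omega>)) A"
    using h by (rule indep_vars_compose2)
  have int: "integrable M (\<lambda>\<omega>. h y (W y \<omega>))" if "y \<in> A" for y
    using that b h W_measurable A
    by (intro integrable_const_bound[where B = C]) (auto intro: measurable_compose)
  show "integrable M (\<lambda>\<omega>. \<Prod>y\<in>A. h y (W y \<omega>))"
    by (rule indep_vars_integrable[OF fA ind int])
  show "(\<integral>\<omega>. (\<Prod>y\<in>A. h y (W y \<omega>)) \<partial>M) = (\<Prod>y\<in>A. \<integral>\<omega>. h y (W y \<omega>) \<partial>M)"
    by (rule indep_vars_lebesgue_integral[OF fA ind int])
qed

lemma AE_W_ge_1: "AE \<omega> in M. \<forall>x\<in>torus N. 1 \<le> W x \<omega>"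
proof (rule AE_finite_allI)
  fix x assume x: "x \<in> torus N"
  have "{\<omega> \<in> space M. 1 \<le> W x \<omega>} \<in> events" using W_measurable[OF x] by measurable
  then show "AE \<omega> in M. 1 \<le> W x \<omega>"
    using weights_pareto[OF x, of 1] by (auto simp: prob_Collect_eq_1)
qed simp

lemma integral_weight_tail:
  assumes "x \<in> torus N"
  shows "(\<integral>\<omega>. of_bool (t \<le> W x \<omega>) \<partial>M) = (if 1 \<le> t then t powr (- (\<tau> - 1)) else 1)"
proof -
  have "(\<integral>\<omega>. of_bool (t \<le> W x \<omega>) \<partial>M) = (\<integral>\<omega>. indicator {\<omega> \<in> space M. t \<le> W x \<omega>} \<omega> \<partial>M)"
    by (rule Bochner_Integration.integral_cong) (auto simp: indicator_def)
  also have "\<dots> = prob {\<omega> \<in> space M. t \<le> W x \<omega>}"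
    using W_measurable[OF assms] by simp
  finally show ?thesis using weights_pareto[OF assms, of t] by simp
qed

section \<open>Concentration of cuts, degrees and weight counts\<close>

definition expected_cut :: "nat set \<Rightarrow> 'a \<Rightarrow> real" where
  "expected_cut S \<omega> = (\<Sum>x\<in>S. \<Sum>y\<in>torus N - S. edge_prob \<omega> x y)"

definition edge_cut :: "nat set \<Rightarrow> 'a \<Rightarrow> real" where
  "edge_cut S \<omega> = (\<Sum>x\<in>S. \<Sum>y\<in>torus N - S. of_bool ({x, y} \<in> G \<omega>))"

lemma edge_prob_nonneg:
  assumes "1 \<le> W x \<omega>" "1 \<le> W y \<omega>"
  shows "0 \<le> edge_prob \<omega> x y"
  using assms by (simp add: edge_prob_def divide_nonneg_nonneg)

lemma edge_cut_measurable: "S \<subseteq> torus N \<Longrightarrow> edge_cut S \<in> borel_measurable M"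
  unfolding edge_cut_def[abs_def]
  by (intro borel_measurable_sum edge_indicator_measurable) auto

lemma expected_cut_measurable: "S \<subseteq> torus N \<Longrightarrow> expected_cut S \<in> borel_measurable M"
  unfolding expected_cut_def[abs_def]
  by (intro borel_measurable_sum edge_prob_measurable) auto

text \<open>
  Markov's inequality for \<open>2 powr (\<mu> / 4 - b - X)\<close>, where \<open>X\<close> counts the random edges across the
  cut and \<open>\<mu>\<close> is their conditional mean. The factor \<open>2 powr (\<mu> / 4 - b)\<close> is a function of the weights and
  may be carried through the conditioning.
  Edges of the cycle only increase the cut relative to its mean, as \<open>edge_prob \<omega> x y \<le> 1\<close>.
\<close>

lemma edge_cut_lower_tail:
  assumes S: "S \<subseteq> torus N"
  shows "{\<omega> \<in> space M. edge_cut S \<omega> < expected_cut S \<omega> / 4 - b} \<in> events"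
    and "prob {\<omega> \<in> space M. edge_cut S \<omega> < expected_cut S \<omega> / 4 - b} \<le> 2 powr (- b)"
proof -
  let ?A = "{\<omega> \<in> space M. edge_cut S \<omega> < expected_cut S \<omega> / 4 - b}"
  show A: "?A \<in> events"
    using edge_cut_measurable[OF S] expected_cut_measurable[OF S] by measurable
  let ?B = "S \<times> (torus N - S)"
  define I where "I = {(x, y). x \<in> S \<and> y \<in> torus N - S \<and> {x, y} \<notin> cycle_edges N}"
  have fS: "finite S" using S by (rule finite_subset) simp
  have IB: "I \<subseteq> ?B" unfolding I_def by auto
  have fI: "finite I" by (rule finite_subset[OF IB]) (intro finite_SigmaI fS finite_Diff finite_torus)
  define m where "m \<omega> = (\<Sum>(x, y)\<in>I. edge_prob \<omega> x y)" for \<omega>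
  define c where "c \<omega> = real (card {(x, y) \<in> I. {x, y} \<in> G \<omega>})" for \<omega>
  have c_sum: "c \<omega> = (\<Sum>(x, y)\<in>I. of_bool ({x, y} \<in> G \<omega>))" for \<omega>
  proof -
    have "(\<Sum>(x, y)\<in>I. of_bool ({x, y} \<in> G \<omega>)) = (\<Sum>z\<in>I. of_bool ({fst z, snd z} \<in> G \<omega>) :: real)"
      by (simp add: split_def)
    also have "\<dots> = real (card (I \<inter> {z. {fst z, snd z} \<in> G \<omega>}))"
      using fI by (simp add: Int_def of_bool_def sum.If_cases)
    also have "I \<inter> {z. {fst z, snd z} \<in> G \<omega>} = {(x, y) \<in> I. {x, y} \<in> G \<omega>}" by auto
    finally show ?thesis by (simp add: c_def)
  qed
  have I_in: "x \<in> torus N" "y \<in> torus N" if "(x, y) \<in> I" for x y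
    using that S by (auto simp: I_def)
  have mM: "m \<in> borel_measurable weight_algebra"
    unfolding m_def[abs_def] split_def
    by (intro borel_measurable_sum edge_prob_measurable_weight_algebra) (auto intro: I_in)
  have m_le: "m \<omega> \<le> card I" for \<omega>
    unfolding m_def using sum_bounded_above[of I "\<lambda>z. case z of (x, y) \<Rightarrow> edge_prob \<omega> x y" 1] edge_prob_le_1
    by (auto simp: split_def)
  define g where "g \<omega> = 2 powr (m \<omega> / 4 - b)" for \<omega>
  have gM: "g \<in> borel_measurable weight_algebra"
    unfolding g_def[abs_def] using mM by measurable
  have gC: "\<bar>g \<omega>\<bar> \<le> 2 powr (card I / 4 - b)" for \<omega>
    unfolding g_def using m_le[of \<omega>] by simp
  note gf = boundary_generating_function[OF S _ gM gC, of I "- 1 / 2", unfolded I_def[symmetric], OF subset_refl]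
  have prodG: "(\<Prod>(x, y)\<in>I. 1 + (- 1 / 2) * of_bool ({x, y} \<in> G \<omega>)) = 2 powr (- c \<omega>)" for \<omega>
  proof -
    have "(\<Prod>(x, y)\<in>I. 1 + (- 1 / 2) * of_bool ({x, y} \<in> G \<omega>))
        = (\<Prod>z\<in>I. 1 + (- 1 / 2) * (of_bool ({fst z, snd z} \<in> G \<omega>)::real))"
      by (simp add: split_def)
    also have "\<dots> = (1 + (- 1 / 2)) ^ card {z \<in> I. {fst z, snd z} \<in> G \<omega>}"
      by (rule prod_exp_of_bool[OF fI])
    also have "{z \<in> I. {fst z, snd z} \<in> G \<omega>} = {(x, y) \<in> I. {x, y} \<in> G \<omega>}" by auto
    also have "(1 + (- 1 / 2) :: real) ^ card {(x, y) \<in> I. {x, y} \<in> G \<omega>} = 2 powr (- c \<omega>)"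
      unfolding c_def by (simp add: powr_minus powr_realpow power_one_over inverse_eq_divide)
    finally show ?thesis .
  qed
  have "prob ?A \<le> expectation (\<lambda>\<omega>. g \<omega> * (\<Prod>(x, y)\<in>I. 1 + (- 1 / 2) * of_bool ({x, y} \<in> G \<omega>)))"
  proof (rule prob_le_expectation[OF A gf(1)])
    show "AE \<omega> in M. 0 \<le> g \<omega> * (\<Prod>(x, y)\<in>I. 1 + (- 1 / 2) * of_bool ({x, y} \<in> G \<omega>))"
      unfolding prodG g_def by auto
    fix \<omega> assume "\<omega> \<in> ?A"
    then have \<omega>: "\<omega> \<in> space M" and lt: "edge_cut S \<omega> < expected_cut S \<omega> / 4 - b" by auto
    have "edge_cut S \<omega> = c \<omega> + (\<Sum>(x, y)\<in>?B - I. of_bool ({x, y} \<in> G \<omega>))"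
      unfolding edge_cut_def c_sum sum.cartesian_product using fS IB
      by (subst sum.subset_diff[of I]) auto
    moreover have "expected_cut S \<omega> = m \<omega> + (\<Sum>(x, y)\<in>?B - I. edge_prob \<omega> x y)"
      unfolding expected_cut_def m_def sum.cartesian_product using fS IB
      by (subst sum.subset_diff[of I]) auto
    moreover have "(\<Sum>(x, y)\<in>?B - I. edge_prob \<omega> x y) \<le> real (card (?B - I)) * 1"
      using edge_prob_le_1 by (intro sum_bounded_above) auto
    moreover have "(\<Sum>(x, y)\<in>?B - I. of_bool ({x, y} \<in> G \<omega>)) = (\<Sum>z\<in>?B - I. 1::real)"
      using cycle_present[OF \<omega>] by (intro sum.cong) (auto simp: I_def)
    moreover have "(\<Sum>z\<in>?B - I. 1::real) = real (card (?B - I))" "0 \<le> real (card (?B - I))" by simp_all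
    ultimately have "c \<omega> < m \<omega> / 4 - b" using lt by argo
    then show "1 \<le> g \<omega> * (\<Prod>(x, y)\<in>I. 1 + (- 1 / 2) * of_bool ({x, y} \<in> G \<omega>))"
      unfolding prodG g_def powr_add[symmetric] by (intro ge_one_powr_ge_zero) auto
  qed
  also have "\<dots> = expectation (\<lambda>\<omega>. g \<omega> * (\<Prod>(x, y)\<in>I. 1 + (- 1 / 2) * edge_prob \<omega> x y))"
    by (rule gf(3))
  also have "\<dots> \<le> expectation (\<lambda>\<omega>. 2 powr (- b))"
  proof (rule integral_mono_AE[OF gf(2)])
    show "AE \<omega> in M. g \<omega> * (\<Prod>(x, y)\<in>I. 1 + (- 1 / 2) * edge_prob \<omega> x y) \<le> 2 powr (- b)"
      using AE_W_ge_1
    proof eventually_elim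
      case (elim \<omega>)
      have p0: "0 \<le> edge_prob \<omega> x y" if "(x, y) \<in> I" for x y
        using elim I_in[OF that] by (intro edge_prob_nonneg) auto
      have m0: "0 \<le> m \<omega>" unfolding m_def using p0 by (intro sum_nonneg) auto
      have "2 powr (m \<omega> / 4) * (\<Prod>(x, y)\<in>I. 1 + (- 1 / 2) * edge_prob \<omega> x y) \<le> exp (- (m \<omega> / 4))"
        unfolding m_def split_def using p0 edge_prob_le_1 fI by (intro exp_minus_half_product) auto
      also have "\<dots> \<le> 1" using m0 by simp
      finally have "2 powr (- b) * (2 powr (m \<omega> / 4) * (\<Prod>(x, y)\<in>I. 1 + (- 1 / 2) * edge_prob \<omega> x y)) \<le> 2 powr (- b) * 1"
        by (intro mult_left_mono) auto
      moreover have "g \<omega> = 2 powr (- b) * 2 powr (m \<omega> / 4)"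
        by (simp add: g_def powr_add[symmetric])
      ultimately show ?case by (simp only: mult.assoc mult_1_right)
    qed
  qed simp
  finally show "prob ?A \<le> 2 powr (- b)" by (simp add: prob_space)
qed

text \<open>
  With \<open>b = 4 * card S * log 2 N\<close> the failure probabilities are \<open>(N\<^sup>-\<^sup>4) ^ card S\<close>, and their sum
  over all nonempty \<open>S\<close> is \<open>(1 + N\<^sup>-\<^sup>4)\<^sup>N - 1\<close> by the binomial theorem.
\<close>

lemma all_cuts_lower_tail:
  assumes N: "2 \<le> N"
  shows "{\<omega> \<in> space M. \<exists>S\<in>Pow (torus N) - {{}}. edge_cut S \<omega> < expected_cut S \<omega> / 4 - 4 * real (card S) * log 2 N} \<in> events"
    (is "?A \<in> _")
    and "prob {\<omega> \<in> space M. \<exists>S\<in>Pow (torus N) - {{}}. edge_cut S \<omega> < expected_cut S \<omega> / 4 - 4 * real (card S) * log 2 N}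
      \<le> 2 / real N ^ 3"
proof -
  let ?E = "\<lambda>S. {\<omega> \<in> space M. edge_cut S \<omega> < expected_cut S \<omega> / 4 - 4 * real (card S) * log 2 N}"
  have eq: "?A = (\<Union>S\<in>Pow (torus N) - {{}}. ?E S)" by auto
  have E: "?E ` (Pow (torus N) - {{}}) \<subseteq> events" using edge_cut_lower_tail(1) by auto
  show "?A \<in> events" unfolding eq using E by (intro sets.finite_UN) auto
  have "prob ?A \<le> (\<Sum>S\<in>Pow (torus N) - {{}}. prob (?E S))"
    unfolding eq using E by (intro finite_measure_subadditive_finite) auto
  also have "\<dots> \<le> (\<Sum>S\<in>Pow (torus N) - {{}}. (1 / real N ^ 4) ^ card S)"
  proof (intro sum_mono)
    fix S assume "S \<in> Pow (torus N) - {{}}"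
    then have "prob (?E S) \<le> 2 powr (- (4 * real (card S) * log 2 N))"
      by (intro edge_cut_lower_tail(2)) auto
    also have "2 powr (- (4 * real (card S) * log 2 N)) = (2 powr (log 2 N)) powr (- (4 * real (card S)))"
      by (simp add: powr_powr mult.commute)
    also have "\<dots> = real N powr (- real (4 * card S))" using N by simp
    also have "\<dots> = (1 / real N ^ 4) ^ card S"
      using N by (simp only: powr_minus powr_realpow[of "real N" "4 * card S"])
        (simp add: power_mult power_one_over inverse_eq_divide)
    finally show "prob (?E S) \<le> (1 / real N ^ 4) ^ card S" .
  qed
  also have "\<dots> = (1 + 1 / real N ^ 4) ^ N - 1"
    by (subst sum_one_over_power_card) (auto simp: torus_def)
  also have "(1 + 1 / real N ^ 4) ^ N \<le> exp (1 / real N ^ 4) ^ N"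
    using exp_ge_add_one_self by (intro power_mono) (auto simp: add.commute)
  also have "exp (1 / real N ^ 4) ^ N = exp (1 / real N ^ 3)"
    using N by (simp add: exp_of_nat_mult[symmetric] power_numeral_reduce field_simps)
  also have "exp (1 / real N ^ 3) - 1 \<le> 2 * (1 / real N ^ 3)"
    using N by (intro exp_minus_one_le_double) auto
  finally show "prob ?A \<le> 2 / real N ^ 3" by simp
qed

text \<open>
  The dyadic term of index \<open>k\<close> contributes \<open>(1/2)\<^sup>k * ((1/2)\<^sup>k\<^sup>+\<^sup>1 / s) powr (- \<theta>)\<close>, which is at most
  \<open>2 * s powr \<theta>\<close> since \<open>\<theta> \<le> 1\<close>. Both \<open>\<theta> = 1\<close> for light tails and \<open>\<theta> = \<tau> - 1\<close> for heavy ones are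
  covered, at the cost of the number \<open>K\<close> of terms.
\<close>

lemma integral_clamp_weight_le:
  assumes x: "x \<in> torus N" and \<theta>: "0 < \<theta>" "\<theta> \<le> 1" "\<theta> \<le> \<tau> - 1"
    and s: "0 < s" and K: "(1/2) ^ K \<le> s powr \<theta>"
  shows "(\<integral>\<omega>. clamp (s * W x \<omega>) \<partial>M) \<le> (2 * real K + 1) * s powr \<theta>"
proof -
  have tail: "(\<integral>\<omega>. of_bool (t \<le> W x \<omega>) \<partial>M) \<le> t powr (- \<theta>)" if t: "0 < t" for t
  proof (cases "1 \<le> t")
    case True
    then have "t powr (- (\<tau> - 1)) \<le> t powr (- \<theta>)" using \<theta> by (intro powr_mono) auto
    then show ?thesis using True by (simp add: integral_weight_tail[OF x])
  next
    case False
    then have "1 \<le> t powr (- \<theta>)"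
      using t \<theta> powr_mono2[of \<theta> t 1] by (simp add: powr_minus one_le_inverse)
    then show ?thesis using False by (simp add: integral_weight_tail[OF x])
  qed
  have Wm [measurable]: "W x \<in> borel_measurable M" using x by (rule W_measurable)
  have int: "integrable M (\<lambda>\<omega>. of_bool (c \<le> W x \<omega>) :: real)" for c
    by (intro integrable_const_bound[where B = 1]) auto
  have "(\<integral>\<omega>. clamp (s * W x \<omega>) \<partial>M)
      \<le> (\<integral>\<omega>. (\<Sum>k<K. (1/2) ^ k * of_bool ((1/2) ^ Suc k / s \<le> W x \<omega>)) + (1/2) ^ K \<partial>M)"
  proof (rule integral_mono)
    show "integrable M (\<lambda>\<omega>. clamp (s * W x \<omega>))"
      using clamp_bounds unfolding clamp_def
      by (intro integrable_const_bound[where B = 1]) auto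
    show "integrable M (\<lambda>\<omega>. (\<Sum>k<K. (1/2) ^ k * of_bool ((1/2) ^ Suc k / s \<le> W x \<omega>)) + (1/2) ^ K :: real)"
      by (intro Bochner_Integration.integrable_add Bochner_Integration.integrable_sum
          integrable_mult_right int) simp_all
    show "clamp (s * W x \<omega>) \<le> (\<Sum>k<K. (1/2) ^ k * of_bool ((1/2) ^ Suc k / s \<le> W x \<omega>)) + (1/2) ^ K" for \<omega>
    proof -
      have "((1/2) ^ Suc k / s \<le> W x \<omega>) = ((1/2) ^ Suc k \<le> s * W x \<omega>)" for k
        using s by (simp only: pos_divide_le_eq) (simp only: mult.commute)
      then show ?thesis using clamp_dyadic[of "s * W x \<omega>" K] by (simp only:)
    qed
  qed
  also have "\<dots> = (\<Sum>k<K. (1/2) ^ k * (\<integral>\<omega>. of_bool ((1/2) ^ Suc k / s \<le> W x \<omega>) \<partial>M)) + (1/2) ^ K"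
  proof -
    have "(\<integral>\<omega>. (\<Sum>k<K. (1/2::real) ^ k * of_bool ((1/2) ^ Suc k / s \<le> W x \<omega>)) \<partial>M)
        = (\<Sum>k<K. (\<integral>\<omega>. (1/2::real) ^ k * of_bool ((1/2) ^ Suc k / s \<le> W x \<omega>) \<partial>M))"
      by (intro Bochner_Integration.integral_sum integrable_mult_right int)
    moreover have "(\<integral>\<omega>. (\<Sum>k<K. (1/2::real) ^ k * of_bool ((1/2) ^ Suc k / s \<le> W x \<omega>)) + (1/2) ^ K \<partial>M)
        = (\<integral>\<omega>. (\<Sum>k<K. (1/2::real) ^ k * of_bool ((1/2) ^ Suc k / s \<le> W x \<omega>)) \<partial>M) + (\<integral>\<omega>. (1/2) ^ K \<partial>M)"
      by (intro Bochner_Integration.integral_add Bochner_Integration.integrable_sum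
          integrable_mult_right int) simp
    ultimately show ?thesis by (simp only: integral_mult_right_zero) (simp add: prob_space)
  qed
  also have "\<dots> \<le> (\<Sum>k<K. 2 * s powr \<theta>) + s powr \<theta>"
  proof (intro add_mono sum_mono K)
    fix k
    have "(1/2) ^ k * (\<integral>\<omega>. of_bool ((1/2) ^ Suc k / s \<le> W x \<omega>) \<partial>M)
       \<le> (1/2) ^ k * ((1/2) ^ Suc k / s) powr (- \<theta>)"
      using s by (intro mult_left_mono tail) auto
    also have "((1/2) ^ Suc k / s) powr (- \<theta>) = (2 ^ Suc k * s) powr \<theta>"
    proof -
      have "(1/2) ^ Suc k / s = inverse (2 ^ Suc k * s)"
        using s by (simp add: power_one_over divide_simps)
      then show ?thesis by (simp only: inverse_powr powr_minus inverse_inverse_eq)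
    qed
    also have "\<dots> = (2 ^ Suc k) powr \<theta> * s powr \<theta>" using s by (simp add: powr_mult)
    also have "(1/2) ^ k * ((2 ^ Suc k) powr \<theta> * s powr \<theta>) \<le> (1/2) ^ k * (2 ^ Suc k * s powr \<theta>)"
    proof -
      have "(2 ^ Suc k) powr \<theta> \<le> (2 ^ Suc k :: real) powr 1"
        using \<theta> by (intro powr_mono one_le_power) auto
      then have "(2 ^ Suc k) powr \<theta> \<le> (2 ^ Suc k :: real)" by (simp del: power_Suc)
      then show ?thesis by (intro mult_left_mono mult_right_mono) auto
    qed
    also have "\<dots> = 2 * s powr \<theta>" by (simp add: power_one_over)
    finally show "(1/2) ^ k * (\<integral>\<omega>. of_bool ((1/2) ^ Suc k / s \<le> W x \<omega>) \<partial>M) \<le> 2 * s powr \<theta>" .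
  qed
  finally show ?thesis by (simp add: algebra_simps)
qed

definition free_degree :: "nat \<Rightarrow> 'a \<Rightarrow> nat" where
  "free_degree x \<omega> = card {y \<in> torus N - {x}. {x, y} \<notin> cycle_edges N \<and> {x, y} \<in> G \<omega>}"

text \<open>
  The bound \<open>(u / d\<^sup>\<alpha>) powr \<theta>\<close> for a vertex at distance \<open>d\<close> is replaced by the larger
  \<open>N * (u / N\<^sup>\<alpha>) powr \<theta> / d\<close>, which is possible since \<open>\<alpha> * \<theta> \<le> 1\<close>. This reduces the sum
  over the torus to a harmonic one, losing only a logarithm.
\<close>

lemma expected_degree_bound:
  assumes x: "x \<in> torus N" and \<alpha>: "0 < \<alpha>" and \<theta>: "0 < \<theta>" "\<theta> \<le> 1" "\<theta> \<le> \<tau> - 1" "\<alpha> * \<theta> \<le> 1"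
    and u: "1 \<le> u" and K: "(1/2) ^ K \<le> (u / real N powr \<alpha>) powr \<theta>"
  shows "(\<Sum>y\<in>torus N - {x}. \<integral>\<omega>. clamp (u / torus_dist N x y powr \<alpha> * W y \<omega>) \<partial>M)
    \<le> (2 * real K + 1) * (4 * (1 + ln (real N))) * (real N * (u / real N powr \<alpha>) powr \<theta>)"
proof -
  have N: "1 \<le> real N" using x by (auto simp: torus_def)
  have "(\<Sum>y\<in>torus N - {x}. \<integral>\<omega>. clamp (u / torus_dist N x y powr \<alpha> * W y \<omega>) \<partial>M)
     \<le> (\<Sum>y\<in>torus N - {x}. (2 * real K + 1) * (real N * (u / real N powr \<alpha>) powr \<theta>) * (1 / torus_dist N x y))"
  proof (rule sum_mono)
    fix y assume y: "y \<in> torus N - {x}"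
    define d where "d = torus_dist N x y"
    have d: "1 \<le> d" "d \<le> real N" unfolding d_def using torus_dist_bounds[of x N y] x y by auto
    have eq: "(u / r powr \<alpha>) powr \<theta> = u powr \<theta> * r powr (- (\<alpha> * \<theta>))" if "0 < r" for r
    proof -
      have "(u / r powr \<alpha>) powr \<theta> = u powr \<theta> / (r powr \<alpha>) powr \<theta>"
        using u by (simp add: powr_divide)
      then show ?thesis by (simp add: powr_powr powr_minus divide_inverse)
    qed
    have "d powr (1 - \<alpha> * \<theta>) \<le> real N powr (1 - \<alpha> * \<theta>)"
      using d \<theta> by (intro powr_mono2) auto
    then have "d * d powr (- (\<alpha> * \<theta>)) \<le> real N * real N powr (- (\<alpha> * \<theta>))"
      using d N by (simp add: powr_diff powr_minus divide_inverse)
    then have "d powr (- (\<alpha> * \<theta>)) \<le> real N * real N powr (- (\<alpha> * \<theta>)) * (1 / d)"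
      using d by (simp add: field_simps)
    then have "u powr \<theta> * d powr (- (\<alpha> * \<theta>)) \<le> u powr \<theta> * (real N * real N powr (- (\<alpha> * \<theta>)) * (1 / d))"
      by (intro mult_left_mono) auto
    then have le: "(u / d powr \<alpha>) powr \<theta> \<le> real N * (u / real N powr \<alpha>) powr \<theta> * (1 / d)"
      using d N by (simp add: eq algebra_simps)
    have "u / real N powr \<alpha> \<le> u / d powr \<alpha>"
      using d u \<alpha> by (intro divide_left_mono powr_mono2) auto
    then have "(u / real N powr \<alpha>) powr \<theta> \<le> (u / d powr \<alpha>) powr \<theta>"
      using u \<theta> by (intro powr_mono2) auto
    then have "(\<integral>\<omega>. clamp (u / d powr \<alpha> * W y \<omega>) \<partial>M) \<le> (2 * real K + 1) * (u / d powr \<alpha>) powr \<theta>"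
      using y d u K by (intro integral_clamp_weight_le \<theta>) auto
    also have "\<dots> \<le> (2 * real K + 1) * (real N * (u / real N powr \<alpha>) powr \<theta> * (1 / d))"
      using le by (intro mult_left_mono) auto
    finally show "(\<integral>\<omega>. clamp (u / torus_dist N x y powr \<alpha> * W y \<omega>) \<partial>M)
      \<le> (2 * real K + 1) * (real N * (u / real N powr \<alpha>) powr \<theta>) * (1 / torus_dist N x y)"
      by (simp add: d_def mult.assoc)
  qed
  also have "\<dots> = (2 * real K + 1) * (real N * (u / real N powr \<alpha>) powr \<theta>) * (\<Sum>y\<in>torus N - {x}. 1 / torus_dist N x y)"
    by (simp add: sum_distrib_left)
  also have "\<dots> \<le> (2 * real K + 1) * (real N * (u / real N powr \<alpha>) powr \<theta>) * (4 * (1 + ln (real N)))"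
    by (intro mult_left_mono sum_inverse_torus_dist x) auto
  finally show ?thesis by (simp only: mult_ac)
qed

lemma free_degree_eq_sum:
  "real (free_degree x \<omega>)
     = (\<Sum>y\<in>{y \<in> torus N - {x}. {x, y} \<notin> cycle_edges N}. of_bool ({x, y} \<in> G \<omega>))"
proof -
  have "{y \<in> torus N - {x}. {x, y} \<notin> cycle_edges N \<and> {x, y} \<in> G \<omega>}
    = {y \<in> torus N - {x}. {x, y} \<notin> cycle_edges N} \<inter> {y. {x, y} \<in> G \<omega>}" by auto
  then show ?thesis unfolding free_degree_def of_bool_def
    by (simp add: sum.If_cases)
qed

text \<open>
  The bound on the weight of \<open>x\<close> itself is put into the event. Then the edge probabilities are bounded by
  functions of the other endpoint's weight alone, and the expectation factorises by
  independence of the weights.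
\<close>

lemma free_degree_upper_tail:
  assumes x: "x \<in> torus N" and u: "1 \<le> u"
    and m: "(\<Sum>y\<in>torus N - {x}. \<integral>\<omega>. clamp (u / torus_dist N x y powr \<alpha> * W y \<omega>) \<partial>M) \<le> m"
  shows "{\<omega> \<in> space M. W x \<omega> \<le> u \<and> 4 * m \<le> real (free_degree x \<omega>)} \<in> events"
    and "prob {\<omega> \<in> space M. W x \<omega> \<le> u \<and> 4 * m \<le> real (free_degree x \<omega>)} \<le> exp (- m)"
proof -
  let ?A = "{\<omega> \<in> space M. W x \<omega> \<le> u \<and> 4 * m \<le> real (free_degree x \<omega>)}"
  have [measurable]: "W x \<in> borel_measurable M" using x by (rule W_measurable)
  have [measurable]: "(\<lambda>\<omega>. real (free_degree x \<omega>)) \<in> borel_measurable M"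
    unfolding free_degree_eq_sum using x by (intro borel_measurable_sum edge_indicator_measurable) auto
  show A: "?A \<in> events" by measurable
  let ?T = "torus N - {x}"
  define Y where "Y = {y \<in> ?T. {x, y} \<notin> cycle_edges N}"
  define I where "I = Pair x ` Y"
  have fY: "finite Y" unfolding Y_def by auto
  have I_sub: "I \<subseteq> {(x', y). x' \<in> {x} \<and> y \<in> torus N - {x} \<and> {x', y} \<notin> cycle_edges N}"
    unfolding I_def Y_def by auto
  have prodI: "(\<Prod>(x, y)\<in>I. f x y) = (\<Prod>y\<in>Y. f x y)" for f :: "nat \<Rightarrow> nat \<Rightarrow> real"
    unfolding I_def by (subst prod.reindex) (auto simp: inj_on_def)
  define g :: "'a \<Rightarrow> real" where "g \<omega> = 2 powr (- (4 * m)) * of_bool (W x \<omega> \<le> u)" for \<omega>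
  have gM: "g \<in> borel_measurable weight_algebra"
    unfolding g_def[abs_def] using W_measurable_weight_algebra[OF x] by measurable
  have gC: "\<bar>g \<omega>\<bar> \<le> 2 powr (- (4 * m))" for \<omega> unfolding g_def by (auto simp: of_bool_def)
  have "{x} \<subseteq> torus N" using x by auto
  note gf = boundary_generating_function[OF this I_sub gM gC, of 1, unfolded prodI mult_1]
  have prodG: "(\<Prod>y\<in>Y. 1 + of_bool ({x, y} \<in> G \<omega>)) = (2::real) powr real (free_degree x \<omega>)" for \<omega>
  proof -
    have "{y \<in> Y. {x, y} \<in> G \<omega>} = {y \<in> torus N - {x}. {x, y} \<notin> cycle_edges N \<and> {x, y} \<in> G \<omega>}"
      unfolding Y_def by auto
    then show ?thesis
      using prod_exp_of_bool[OF fY, of 1 "\<lambda>y. {x, y} \<in> G \<omega>"]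
      by (simp add: free_degree_def powr_realpow)
  qed
  define h where "h y z = 1 + clamp (u / torus_dist N x y powr \<alpha> * z)" for y z
  have hM: "h y \<in> borel_measurable borel" for y
    unfolding h_def[abs_def] clamp_def by measurable
  have hC: "\<bar>h y z\<bar> \<le> 2" for y z
    using clamp_bounds[of "u / torus_dist N x y powr \<alpha> * z"] unfolding h_def by auto
  note wp = weights_product[of ?T h 2, OF Diff_subset hM hC]
  have "prob ?A \<le> expectation (\<lambda>\<omega>. g \<omega> * (\<Prod>y\<in>Y. 1 + of_bool ({x, y} \<in> G \<omega>)))"
  proof (rule prob_le_expectation[OF A gf(1)])
    show "AE \<omega> in M. 0 \<le> g \<omega> * (\<Prod>y\<in>Y. 1 + of_bool ({x, y} \<in> G \<omega>))"
      unfolding prodG g_def by auto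
    fix \<omega> assume "\<omega> \<in> ?A"
    then show "1 \<le> g \<omega> * (\<Prod>y\<in>Y. 1 + of_bool ({x, y} \<in> G \<omega>))"
      unfolding prodG g_def by (auto simp: powr_add[symmetric] intro: ge_one_powr_ge_zero)
  qed
  also have "\<dots> = expectation (\<lambda>\<omega>. g \<omega> * (\<Prod>y\<in>Y. 1 + edge_prob \<omega> x y))" by (rule gf(3))
  also have "\<dots> \<le> expectation (\<lambda>\<omega>. 2 powr (- (4 * m)) * (\<Prod>y\<in>?T. h y (W y \<omega>)))"
  proof (rule integral_mono_AE[OF gf(2)])
    show "integrable M (\<lambda>\<omega>. 2 powr (- (4 * m)) * (\<Prod>y\<in>?T. h y (W y \<omega>)))"
      by (intro integrable_mult_right wp)
    show "AE \<omega> in M. g \<omega> * (\<Prod>y\<in>Y. 1 + edge_prob \<omega> x y) \<le> 2 powr (- (4 * m)) * (\<Prod>y\<in>?T. h y (W y \<omega>))"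
      using AE_W_ge_1
    proof eventually_elim
      case (elim \<omega>)
      have h1: "1 \<le> h y z" for y z unfolding h_def using clamp_bounds by simp
      show ?case
      proof (cases "W x \<omega> \<le> u")
        case True
        have "(\<Prod>y\<in>Y. 1 + edge_prob \<omega> x y) \<le> (\<Prod>y\<in>Y. h y (W y \<omega>))"
        proof (intro prod_mono conjI)
          fix y assume y: "y \<in> Y"
          define d where "d = torus_dist N x y powr \<alpha>"
          have W: "1 \<le> W x \<omega>" "1 \<le> W y \<omega>" using elim x y by (auto simp: Y_def)
          show "0 \<le> 1 + edge_prob \<omega> x y" using edge_prob_nonneg[of x \<omega> y] W by auto
          have "edge_prob \<omega> x y \<le> W x \<omega> * W y \<omega> / d"
            unfolding edge_prob_def d_def
            using exp_ge_add_one_self[of "- (W x \<omega> * W y \<omega>) / torus_dist N x y powr \<alpha>"] by simp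
          also have "\<dots> \<le> u / d * W y \<omega>"
            using True W by (simp add: d_def divide_right_mono mult_right_mono)
          finally have "edge_prob \<omega> x y \<le> clamp (u / d * W y \<omega>)"
            using edge_prob_le_1[of \<omega> x y] by (simp add: clamp_def)
          then show "1 + edge_prob \<omega> x y \<le> h y (W y \<omega>)" by (simp add: h_def d_def)
        qed
        also have "\<dots> \<le> (\<Prod>y\<in>?T. h y (W y \<omega>))"
          using h1 by (intro prod_mono2) (auto simp: Y_def intro: order_trans[OF zero_le_one])
        finally show ?thesis using True unfolding g_def by (intro mult_mono) (auto intro!: prod_nonneg
           simp: order_trans[OF zero_le_one h1] edge_prob_nonneg elim x Y_def)
      next
        case False
        then show ?thesis unfolding g_def
          by (auto intro!: prod_nonneg mult_nonneg_nonneg order_trans[OF zero_le_one h1])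
      qed
    qed
  qed
  also have "\<dots> = 2 powr (- (4 * m)) * (\<Prod>y\<in>?T. 1 + (\<integral>\<omega>. clamp (u / torus_dist N x y powr \<alpha> * W y \<omega>) \<partial>M))"
  proof -
    have "(\<integral>\<omega>. h y (W y \<omega>) \<partial>M) = 1 + (\<integral>\<omega>. clamp (u / torus_dist N x y powr \<alpha> * W y \<omega>) \<partial>M)"
      if y: "y \<in> ?T" for y
    proof -
      have [measurable]: "W y \<in> borel_measurable M" using y by (intro W_measurable) auto
      have "integrable M (\<lambda>\<omega>. clamp (u / torus_dist N x y powr \<alpha> * W y \<omega>))"
        using clamp_bounds unfolding clamp_def
        by (intro integrable_const_bound[where B = 1]) auto
      then show ?thesis unfolding h_def
        by (subst Bochner_Integration.integral_add) (auto simp: prob_space)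
    qed
    then show ?thesis using wp(2) by simp
  qed
  also have "\<dots> \<le> exp (- m)"
    using m clamp_bounds by (intro exp_one_plus_product) (auto intro!: integral_nonneg)
  finally show "prob ?A \<le> exp (- m)" .
qed

definition heavy_count :: "real \<Rightarrow> 'a \<Rightarrow> nat" where
  "heavy_count t \<omega> = card {x \<in> torus N. t \<le> W x \<omega>}"

lemma heavy_count_concentration:
  assumes \<tau>: "1 < \<tau>" and t: "1 \<le> t"
  defines "m \<equiv> real N * t powr (- (\<tau> - 1))"
  shows "{\<omega> \<in> space M. 4 * m < real (heavy_count t \<omega>) \<or> real (heavy_count t \<omega>) < m / 4} \<in> events"
    and "prob {\<omega> \<in> space M. 4 * m < real (heavy_count t \<omega>) \<or> real (heavy_count t \<omega>) < m / 4} \<le> 2 * exp (- (m / 4))"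
proof -
  let ?T = "torus N" and ?q = "t powr (- (\<tau> - 1))"
  let ?U = "{\<omega> \<in> space M. 4 * m < real (heavy_count t \<omega>)}"
  let ?L = "{\<omega> \<in> space M. real (heavy_count t \<omega>) < m / 4}"
  have count_sum: "real (heavy_count t \<omega>) = (\<Sum>x\<in>?T. of_bool (t \<le> W x \<omega>))" for \<omega>
    unfolding heavy_count_def of_bool_def by (simp add: sum.If_cases Int_def)
  have "(\<lambda>\<omega>. of_bool (t \<le> W x \<omega>) :: real) \<in> borel_measurable M" if "x \<in> ?T" for x
    using W_measurable[OF that] by measurable
  then have [measurable]: "(\<lambda>\<omega>. real (heavy_count t \<omega>)) \<in> borel_measurable M"
    unfolding count_sum by (rule borel_measurable_sum)
  have U: "?U \<in> events" and L: "?L \<in> events" by measurable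
  have un: "{\<omega> \<in> space M. 4 * m < real (heavy_count t \<omega>) \<or> real (heavy_count t \<omega>) < m / 4} = ?U \<union> ?L" by auto
  show "{\<omega> \<in> space M. 4 * m < real (heavy_count t \<omega>) \<or> real (heavy_count t \<omega>) < m / 4} \<in> events"
    unfolding un using U L by auto
  have m0: "0 \<le> m" unfolding m_def by simp
  have "0 < t" using t by simp
  have q1: "?q \<le> 1" using powr_mono[of "- (\<tau> - 1)" 0 t] t \<tau> by simp
  have gen: "integrable M (\<lambda>\<omega>. \<Prod>x\<in>?T. 1 + c * of_bool (t \<le> W x \<omega>))"
    "(\<integral>\<omega>. (\<Prod>x\<in>?T. 1 + c * of_bool (t \<le> W x \<omega>)) \<partial>M) = (\<Prod>x\<in>?T. 1 + c * ?q)" for c :: real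
  proof -
    define h where "h x z = 1 + c * of_bool (t \<le> z)" for x :: nat and z :: real
    have hM: "h x \<in> borel_measurable borel" for x unfolding h_def[abs_def] by measurable
    have hC: "\<bar>h x z\<bar> \<le> 1 + \<bar>c\<bar>" for x z unfolding h_def by auto
    note wp = weights_product[of ?T h "1 + \<bar>c\<bar>", OF subset_refl hM hC]
    show "integrable M (\<lambda>\<omega>. \<Prod>x\<in>?T. 1 + c * of_bool (t \<le> W x \<omega>))" using wp(1) by (simp add: h_def)
    have "(\<integral>\<omega>. h x (W x \<omega>) \<partial>M) = 1 + c * ?q" if x: "x \<in> ?T" for x
    proof -
      have [measurable]: "W x \<in> borel_measurable M" using x by (rule W_measurable)
      have "integrable M (\<lambda>\<omega>. of_bool (t \<le> W x \<omega>) :: real)"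
        by (intro integrable_const_bound[where B = 1]) auto
      then show ?thesis unfolding h_def
        using integral_weight_tail[OF x, of t] t
        by (subst Bochner_Integration.integral_add) (auto simp: prob_space)
    qed
    then show "(\<integral>\<omega>. (\<Prod>x\<in>?T. 1 + c * of_bool (t \<le> W x \<omega>)) \<partial>M) = (\<Prod>x\<in>?T. 1 + c * ?q)"
      using wp(2) unfolding h_def by simp
  qed
  have pw: "(\<Prod>x\<in>?T. 1 + c * of_bool (t \<le> W x \<omega>)) = (1 + c) powr real (heavy_count t \<omega>)"
    if "0 < 1 + c" for \<omega> and c :: real
    using that prod_exp_of_bool[OF finite_torus, of c "\<lambda>x. t \<le> W x \<omega>"]
    by (simp add: heavy_count_def powr_realpow)
  have sumq: "(\<Sum>x\<in>?T. ?q) = m" by (simp add: m_def torus_def)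
  have "prob ?U \<le> expectation (\<lambda>\<omega>. 2 powr (- (4 * m)) * (\<Prod>x\<in>?T. 1 + 1 * of_bool (t \<le> W x \<omega>)))"
  proof (rule prob_le_expectation[OF U])
    show "integrable M (\<lambda>\<omega>. 2 powr (- (4 * m)) * (\<Prod>x\<in>?T. 1 + 1 * of_bool (t \<le> W x \<omega>)))"
      by (intro integrable_mult_right gen)
    show "1 \<le> 2 powr (- (4 * m)) * (\<Prod>x\<in>?T. 1 + 1 * of_bool (t \<le> W x \<omega>))" if "\<omega> \<in> ?U" for \<omega>
      using that pw[of 1 \<omega>] by (auto simp: powr_add[symmetric] intro!: ge_one_powr_ge_zero)
  qed (auto intro!: AE_I2 mult_nonneg_nonneg prod_nonneg)
  also have "\<dots> = 2 powr (- (4 * m)) * (\<Prod>x\<in>?T. 1 + ?q)"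
    using gen(2)[of 1] by simp
  also have "\<dots> \<le> exp (- m)"
    using sumq by (intro exp_one_plus_product) auto
  finally have PU: "prob ?U \<le> exp (- m)" .
  have "prob ?L \<le> expectation (\<lambda>\<omega>. 2 powr (m / 4) * (\<Prod>x\<in>?T. 1 + (- 1 / 2) * of_bool (t \<le> W x \<omega>)))"
  proof (rule prob_le_expectation[OF L])
    show "integrable M (\<lambda>\<omega>. 2 powr (m / 4) * (\<Prod>x\<in>?T. 1 + (- 1 / 2) * of_bool (t \<le> W x \<omega>)))"
      by (intro integrable_mult_right gen)
    have eq: "2 powr (m / 4) * (\<Prod>x\<in>?T. 1 + (- 1 / 2) * of_bool (t \<le> W x \<omega>)) = 2 powr (m / 4 - heavy_count t \<omega>)" for \<omega>
      by (subst pw) (auto simp: powr_diff powr_divide)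
    show "1 \<le> 2 powr (m / 4) * (\<Prod>x\<in>?T. 1 + (- 1 / 2) * of_bool (t \<le> W x \<omega>))" if "\<omega> \<in> ?L" for \<omega>
      unfolding eq using that by (auto intro!: ge_one_powr_ge_zero)
    show "AE \<omega> in M. 0 \<le> 2 powr (m / 4) * (\<Prod>x\<in>?T. 1 + (- 1 / 2) * of_bool (t \<le> W x \<omega>))"
      unfolding eq by auto
  qed
  also have "\<dots> = 2 powr (m / 4) * (\<Prod>x\<in>?T. 1 + (- 1 / 2) * ?q)"
    using gen(2)[of "- 1 / 2"] by simp
  also have "\<dots> \<le> exp (- (m / 4))"
    using exp_minus_half_product[of ?T "\<lambda>_. ?q"] q1 sumq by simp
  finally have PL: "prob ?L \<le> exp (- (m / 4))" .
  have "exp (- m) \<le> exp (- (m / 4))" using m0 by simp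
  then show "prob {\<omega> \<in> space M. 4 * m < real (heavy_count t \<omega>) \<or> real (heavy_count t \<omega>) < m / 4} \<le> 2 * exp (- (m / 4))"
    unfolding un using measure_Un_le[OF U L] PU PL by linarith
qed

section \<open>Regular configurations\<close>

text \<open>
  For \<open>\<tau> \<ge> 2\<close> the expectation of \<open>min 1 (s * W)\<close> is governed by the mean of the weight, of order \<open>s\<close> (up
  to a logarithm at \<open>\<tau> = 2\<close>), for \<open>\<tau> < 2\<close> by its tail, of order \<open>s powr (\<tau> - 1)\<close>.
\<close>

definition \<theta> :: real where "\<theta> = min 1 (\<tau> - 1)"
definition scale :: real where "scale = real N powr \<alpha>"
definition levels :: nat where "levels = dyadic_ceiling scale"
definition log_factor :: real where
  "log_factor = (2 * real (dyadic_ceiling (real N)) + 1) * (4 * (1 + ln (real N)))"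

text \<open>
  The properties of a configuration from which fast mixing follows deterministically. Degrees
  are controlled in terms of dyadic upper bounds of the weight, so that only finitely many
  events are involved for each vertex.
\<close>

definition regular :: "'a \<Rightarrow> bool" where
  "regular \<omega> \<longleftrightarrow>
     (\<forall>x\<in>torus N. 1 \<le> W x \<omega>) \<and>
     (\<forall>x\<in>torus N. \<forall>i\<le>levels. W x \<omega> \<le> 2 ^ i \<longrightarrow>
        real (free_degree x \<omega>) < 4 * (log_factor * (real N * (2 ^ i / scale) powr \<theta>))) \<and>
     (\<forall>S\<in>Pow (torus N) - {{}}. expected_cut S \<omega> / 4 - 4 * real (card S) * log 2 N \<le> edge_cut S \<omega>) \<and>
     (\<forall>i\<le>levels. \<forall>t\<in>{2 ^ i, scale / 2 ^ i}. 1 \<le> t \<longrightarrow>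
        real N * t powr (- (\<tau> - 1)) / 4 \<le> heavy_count t \<omega> \<and>
        heavy_count t \<omega> \<le> 4 * (real N * t powr (- (\<tau> - 1))))"

context
  assumes \<tau>: "1 < \<tau>" and \<alpha>: "0 < \<alpha>" and \<gamma>: "\<alpha> * (\<tau> - 1) < 1" and N: "2 \<le> N"
begin

lemma \<theta>_bounds: "0 < \<theta>" "\<theta> \<le> 1" "\<theta> \<le> \<tau> - 1" "\<alpha> * \<theta> < 1"
proof -
  show "0 < \<theta>" "\<theta> \<le> 1" "\<theta> \<le> \<tau> - 1" using \<tau> by (auto simp: \<theta>_def)
  then have "\<alpha> * \<theta> \<le> \<alpha> * (\<tau> - 1)" using \<alpha> by (intro mult_left_mono) auto
  then show "\<alpha> * \<theta> < 1" using \<gamma> by simp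
qed

lemma scale_ge_1: "1 \<le> scale"
  using N \<alpha> by (simp add: scale_def ge_one_powr_ge_zero)

lemma log_factor_ge_1: "1 \<le> log_factor"
proof -
  have "0 \<le> ln (real N)" using N by simp
  then have "1 * 1 \<le> log_factor" unfolding log_factor_def by (intro mult_mono) auto
  then show ?thesis by simp
qed

text \<open>
  The smallest possible profile, that of a vertex of weight one.
\<close>

lemma minimal_profile: "real N * (1 / scale) powr \<theta> = real N powr (1 - \<alpha> * \<theta>)"
  using N by (simp add: scale_def powr_divide powr_powr powr_diff)

lemma not_regular_prob:
  obtains B where "B \<in> events" "\<And>\<omega>. \<omega> \<in> space M - B \<Longrightarrow> regular \<omega>"
    "prob B \<le> real N * (real levels + 1) * exp (- (real N powr (1 - \<alpha> * \<theta>))) + 2 / real N ^ 3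
       + 4 * (real levels + 1) * exp (- (real N powr (1 - \<alpha> * (\<tau> - 1)) * 2 powr (- (\<tau> - 1)) / 4))"
proof -
  let ?T = "torus N"
  define m where "m i = log_factor * (real N * (2 ^ i / scale) powr \<theta>)" for i :: nat
  \<comment> \<open>The exceptional set: light weights (a null set), large degrees, thin cuts, and irregular weight counts.\<close>
  define B1 where "B1 = {\<omega> \<in> space M. \<not> (\<forall>x\<in>?T. 1 \<le> W x \<omega>)}"
  define D where "D z = {\<omega> \<in> space M. W (fst z) \<omega> \<le> 2 ^ snd z \<and> 4 * m (snd z) \<le> real (free_degree (fst z) \<omega>)}" for z
  define B2 where "B2 = (\<Union>z\<in>?T \<times> {..levels}. D z)"
  define B3 where "B3 = {\<omega> \<in> space M. \<exists>S\<in>Pow ?T - {{}}. edge_cut S \<omega> < expected_cut S \<omega> / 4 - 4 * real (card S) * log 2 N}"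
  define H where "H t = {\<omega> \<in> space M. 4 * (real N * t powr (- (\<tau> - 1))) < real (heavy_count t \<omega>) \<or>
      real (heavy_count t \<omega>) < real N * t powr (- (\<tau> - 1)) / 4}" for t
  define X where "X = {t \<in> (\<lambda>i. 2 ^ i) ` {..levels} \<union> (\<lambda>i. scale / 2 ^ i) ` {..levels}. 1 \<le> t}"
  define B4 where "B4 = (\<Union>t\<in>X. H t)"
  have fX: "finite X" unfolding X_def by simp
  have N1: "1 \<le> real N" using N by simp

  have B1: "B1 \<in> events"
  proof -
    have "(\<lambda>\<omega>. 1 \<le> W x \<omega>) \<in> measurable M (count_space UNIV)" if "x \<in> ?T" for x
      using W_measurable[OF that] by measurable
    then have "{\<omega> \<in> space M. 1 \<le> W x \<omega>} \<in> events" if "x \<in> ?T" for x using that by (simp add: pred_def)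
    then have "{\<omega> \<in> space M. \<forall>x\<in>?T. 1 \<le> W x \<omega>} \<in> events"
      by (intro sets.sets_Collect_finite_All') (auto simp: torus_def N N[THEN order_trans[rotated]])
    then show ?thesis unfolding B1_def by (rule sets.sets_Collect_neg)
  qed
  have P1: "prob B1 = 0"
    using AE_W_ge_1 B1 unfolding B1_def by (subst prob_eq_0) auto

  have D: "D z \<in> events" "prob (D z) \<le> exp (- (real N powr (1 - \<alpha> * \<theta>)))"
    if z: "z \<in> ?T \<times> {..levels}" for z
  proof -
    obtain x i where xi: "z = (x, i)" "x \<in> ?T" "i \<le> levels" using z by auto
    \<comment> \<open>This number of dyadic terms makes the remainder at most any \<open>s powr \<theta>\<close> that occurs.\<close>
    have "(1 / 2) ^ dyadic_ceiling (real N) \<le> 1 / real N"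
      using dyadic_ceiling[of "real N"] N1 by (simp add: power_one_over divide_simps)
    also have "\<dots> \<le> real N powr (- (\<alpha> * \<theta>))"
      using powr_mono[of "- 1" "- (\<alpha> * \<theta>)" "real N"] \<theta>_bounds N1 by (simp add: powr_minus_divide)
    also have "\<dots> = (1 / scale) powr \<theta>"
      using N1 by (simp add: scale_def powr_divide powr_powr powr_minus_divide)
    finally have K1: "(1 / 2) ^ dyadic_ceiling (real N) \<le> (1 / scale) powr \<theta>" .
    have le: "(1 / scale) powr \<theta> \<le> (2 ^ i / scale) powr \<theta>"
      using scale_ge_1 \<theta>_bounds by (intro powr_mono2 divide_right_mono) auto
    have K: "(1 / 2) ^ dyadic_ceiling (real N) \<le> (2 ^ i / real N powr \<alpha>) powr \<theta>"
      using K1 le by (simp add: scale_def)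
    have "(\<Sum>y\<in>?T - {x}. \<integral>\<omega>. clamp (2 ^ i / torus_dist N x y powr \<alpha> * W y \<omega>) \<partial>M) \<le> m i"
      using expected_degree_bound[OF xi(2) \<alpha> \<theta>_bounds(1-3) less_imp_le[OF \<theta>_bounds(4)] _ K]
      by (simp add: m_def log_factor_def scale_def)
    note tail = free_degree_upper_tail[OF xi(2) _ this]
    show "D z \<in> events" using tail(1) by (simp add: D_def xi)
    have "real N powr (1 - \<alpha> * \<theta>) = 1 * (real N * (1 / scale) powr \<theta>)" by (simp add: minimal_profile)
    also have "\<dots> \<le> m i"
      unfolding m_def using log_factor_ge_1 le N1 by (intro mult_mono mult_left_mono) auto
    finally have "exp (- m i) \<le> exp (- (real N powr (1 - \<alpha> * \<theta>)))" by simp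
    moreover have "prob (D z) \<le> exp (- m i)" using tail(2) by (simp add: D_def xi)
    ultimately show "prob (D z) \<le> exp (- (real N powr (1 - \<alpha> * \<theta>)))" by linarith
  qed
  have B2: "B2 \<in> events" unfolding B2_def using D(1) by (intro sets.finite_UN) auto
  have "prob B2 \<le> (\<Sum>z\<in>?T \<times> {..levels}. prob (D z))"
    unfolding B2_def using D(1) by (intro finite_measure_subadditive_finite) auto
  also have "\<dots> \<le> real (card (?T \<times> {..levels})) * exp (- (real N powr (1 - \<alpha> * \<theta>)))"
    using D(2) by (intro sum_bounded_above)
  finally have P2: "prob B2 \<le> real N * (real levels + 1) * exp (- (real N powr (1 - \<alpha> * \<theta>)))"
    by (simp add: torus_def card_cartesian_product algebra_simps)

  have B3: "B3 \<in> events" and P3: "prob B3 \<le> 2 / real N ^ 3"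
    unfolding B3_def using all_cuts_lower_tail[OF N] by auto

  define c where "c = real N powr (1 - \<alpha> * (\<tau> - 1)) * 2 powr (- (\<tau> - 1)) / 4"
  have H: "H t \<in> events" "prob (H t) \<le> 2 * exp (- c)" if t: "t \<in> X" for t
  proof -
    have t1: "1 \<le> t" using t by (auto simp: X_def)
    have t2: "t \<le> 2 * scale"
    proof -
      have "(2::real) ^ i \<le> 2 * scale" if "i \<le> levels" for i
        using power_increasing[OF that, of "2::real"] power_dyadic_ceiling_le[OF scale_ge_1]
        unfolding levels_def by linarith
      moreover have "scale / 2 ^ i \<le> 2 * scale" for i
      proof -
        have "scale / 2 ^ i \<le> scale / 1" using scale_ge_1 by (intro divide_left_mono) auto
        then show ?thesis using scale_ge_1 by simp
      qed
      ultimately show ?thesis using t unfolding X_def by auto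
    qed
    show "H t \<in> events" unfolding H_def using heavy_count_concentration(1)[OF \<tau> t1] .
    have "c = real N * (2 * scale) powr (- (\<tau> - 1)) / 4"
    proof -
      have "real N powr (1 - \<alpha> * b) * 2 powr (- b) = real N * (2 * scale) powr (- b)" for b
        using powr_add[of "real N" 1 "- (\<alpha> * b)"] N1 by (simp add: scale_def powr_mult powr_powr)
      then show ?thesis unfolding c_def by (simp only:)
    qed
    also have "\<dots> \<le> real N * t powr (- (\<tau> - 1)) / 4"
      using t1 t2 \<tau> by (intro divide_right_mono mult_left_mono powr_mono2') auto
    finally have "exp (- (real N * t powr (- (\<tau> - 1)) / 4)) \<le> exp (- c)" by simp
    then show "prob (H t) \<le> 2 * exp (- c)"
      using heavy_count_concentration(2)[OF \<tau> t1] unfolding H_def by linarith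
  qed
  have B4: "B4 \<in> events" unfolding B4_def using H(1) fX by (intro sets.finite_UN) auto
  have "prob B4 \<le> (\<Sum>t\<in>X. prob (H t))"
    unfolding B4_def using H(1) fX by (intro finite_measure_subadditive_finite) auto
  also have "\<dots> \<le> real (card X) * (2 * exp (- c))" using H(2) by (intro sum_bounded_above)
  also have "\<dots> \<le> (2 * (real levels + 1)) * (2 * exp (- c))"
  proof (intro mult_right_mono)
    have "card X \<le> card ((\<lambda>i. 2 ^ i) ` {..levels} \<union> (\<lambda>i. scale / 2 ^ i) ` {..levels})"
      unfolding X_def by (intro card_mono) auto
    also have "\<dots> \<le> card {..levels} + card {..levels}"
      by (rule order_trans[OF card_Un_le]) (intro add_mono card_image_le, auto)
    finally show "real (card X) \<le> 2 * (real levels + 1)" by simp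
  qed auto
  finally have P4: "prob B4 \<le> 4 * (real levels + 1) * exp (- c)" by (simp add: algebra_simps)

  let ?B = "B1 \<union> (B2 \<union> (B3 \<union> B4))"
  show ?thesis
  proof (rule that)
    show "?B \<in> events" using B1 B2 B3 B4 by auto
    have "prob ?B \<le> prob B1 + (prob B2 + (prob B3 + prob B4))"
      using measure_Un_le[of B1 M "B2 \<union> (B3 \<union> B4)"] measure_Un_le[of B2 M "B3 \<union> B4"]
        measure_Un_le[of B3 M B4] B1 B2 B3 B4 by auto
    then show "prob ?B \<le> real N * (real levels + 1) * exp (- (real N powr (1 - \<alpha> * \<theta>))) + 2 / real N ^ 3
       + 4 * (real levels + 1) * exp (- (real N powr (1 - \<alpha> * (\<tau> - 1)) * 2 powr (- (\<tau> - 1)) / 4))"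
      using P1 P2 P3 P4 unfolding c_def by linarith
    fix \<omega> assume \<omega>: "\<omega> \<in> space M - ?B"
    show "regular \<omega>"
      unfolding regular_def
    proof (intro conjI ballI allI impI)
      show "1 \<le> W x \<omega>" if "x \<in> ?T" for x using \<omega> that by (auto simp: B1_def)
      show "real (free_degree x \<omega>) < 4 * (log_factor * (real N * (2 ^ i / scale) powr \<theta>))"
        if "x \<in> ?T" "i \<le> levels" "W x \<omega> \<le> 2 ^ i" for x i
      proof -
        have "\<omega> \<notin> D (x, i)" using \<omega> that unfolding B2_def by blast
        then show ?thesis using \<omega> that by (auto simp: D_def m_def)
      qed
      show "expected_cut S \<omega> / 4 - 4 * real (card S) * log 2 N \<le> edge_cut S \<omega>"
        if "S \<in> Pow ?T - {{}}" for S
        using \<omega> that by (auto simp: B3_def not_less)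
      fix i t assume it: "i \<le> levels" "t \<in> {2 ^ i, scale / 2 ^ i}" "1 \<le> t"
      then have "t \<in> X" unfolding X_def by auto
      then have "\<omega> \<notin> H t" using \<omega> unfolding B4_def by blast
      then show "real N * t powr (- (\<tau> - 1)) / 4 \<le> heavy_count t \<omega>"
        "heavy_count t \<omega> \<le> 4 * (real N * t powr (- (\<tau> - 1)))"
        using \<omega> by (auto simp: H_def)
    qed
  qed
qed

text \<open>
  The kernel given to \<open>weighted_vertices\<close> is set to one on the diagonal, which does not occur in any cut,
  because the torus distance vanishes there.
\<close>

lemma regular_t_mix:
  assumes \<omega>: "\<omega> \<in> space M" and reg: "regular \<omega>"
  defines "Q \<equiv> 2048 * (real levels + 1)" and "R \<equiv> 10 * log_factor"
  assumes large: "32 * Q * log 2 N \<le> real N powr (1 - \<alpha> * \<theta>)"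
    and n: "512 * Q\<^sup>2 * R\<^sup>2 * ln (4 * (real N)\<^sup>2) \<le> real n"
  shows "t_mix (torus N) (G \<omega>) \<le> enat n"
proof -
  let ?T = "torus N" and ?w = "\<lambda>x. W x \<omega>"
  let ?q = "\<lambda>x y. if x = y then 1 else edge_prob \<omega> x y"
  note th = \<theta>_bounds and sc1 = scale_ge_1 and lf1 = log_factor_ge_1
  have N1: "1 \<le> real N" using N by simp
  have w1: "1 \<le> ?w x" if "x \<in> ?T" for x using reg that by (auto simp: regular_def)
  interpret wv: weighted_vertices ?T ?w ?q scale \<theta>
  proof
    show "?T \<noteq> {}" using N by (simp add: torus_def)
    show "?q x y = ?q y x" for x y by (simp add: edge_prob_commute)
    fix x y assume xy: "x \<in> ?T" "y \<in> ?T"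
    show "min 1 (?w x * ?w y / scale) / 2 \<le> ?q x y"
    proof (cases "x = y")
      case False
      define d where "d = torus_dist N x y"
      have d: "1 \<le> d" "d \<le> real N" unfolding d_def using torus_dist_bounds[OF xy False] by auto
      have ww: "0 \<le> ?w x * ?w y" using w1[OF xy(1)] w1[OF xy(2)] by simp
      have "0 < d powr \<alpha>" "d powr \<alpha> \<le> scale"
        unfolding scale_def using d \<alpha> by (auto intro!: powr_mono2)
      then have "?w x * ?w y / scale \<le> ?w x * ?w y / d powr \<alpha>"
        using ww sc1 by (intro divide_left_mono) auto
      then have "min 1 (?w x * ?w y / scale) / 2 \<le> min 1 (?w x * ?w y / d powr \<alpha>) / 2" by simp
      also have "\<dots> \<le> 1 - exp (- (?w x * ?w y / d powr \<alpha>))"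
        using ww by (intro half_min_le_one_minus_exp) simp
      finally show ?thesis using False by (simp add: edge_prob_def d_def)
    qed simp
  qed (use w1 sc1 th in auto)
  have ord: "wv.order = real N" unfolding wv.order_def by (simp add: torus_def)
  have prof: "wv.profile x = real N * min 1 ((?w x / scale) powr \<theta>)" for x
    by (simp add: wv.profile_def ord)
  have mean: "wv.mean_cut S = expected_cut S \<omega>" if "S \<subseteq> ?T" for S
    unfolding wv.mean_cut_def expected_cut_def by (intro sum.cong refl) auto
  have heavy: "real (card (wv.heavy i)) = heavy_count (2 ^ i) \<omega>" for i
    by (simp add: wv.heavy_def heavy_count_def)
  have hubs: "real (card (wv.hubs i)) = heavy_count (scale / 2 ^ i) \<omega>" for i
    by (simp add: wv.hubs_def heavy_count_def)
  have isoW: "min (sum wv.profile S) (sum wv.profile (?T - S)) \<le> Q * expected_cut S \<omega>" if S: "S \<subseteq> ?T" for S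
  proof (cases "\<theta> = 1")
    case True
    have "0 \<le> expected_cut S \<omega>"
      unfolding expected_cut_def using S w1 by (intro sum_nonneg edge_prob_nonneg) auto
    then have "4 * expected_cut S \<omega> \<le> Q * expected_cut S \<omega>"
      unfolding Q_def by (intro mult_right_mono) auto
    then show ?thesis using wv.mean_cut_isoperimetry_rank_one[OF S True] mean[OF S] by linarith
  next
    case False
    then have th': "\<theta> = \<tau> - 1" by (auto simp: \<theta>_def min_def split: if_splits)
    have count: "real N * t powr (- \<theta>) / 4 \<le> heavy_count t \<omega> \<and> heavy_count t \<omega> \<le> 4 * (real N * t powr (- \<theta>))"
      if "i \<le> levels" "t \<in> {2 ^ i, scale / 2 ^ i}" "1 \<le> t" for i t
      using reg that unfolding regular_def th' by blast
    have "min (sum wv.profile S) (sum wv.profile (?T - S)) \<le> 2048 * real (levels + 1) * wv.mean_cut S"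
    proof (rule wv.mean_cut_isoperimetry_levels[OF S], unfold ord heavy hubs)
      show "scale \<le> 2 ^ levels" unfolding levels_def by (rule dyadic_ceiling)
      show "2 ^ i < scale" if "i < levels" for i using that unfolding levels_def by (rule less_dyadic_ceiling)
    qed (use count in auto)
    then show ?thesis unfolding mean[OF S] Q_def by (simp add: algebra_simps)
  qed

  have sub: "S \<subseteq> ?T \<Longrightarrow> finite S" for S by (rule finite_subset) auto
  have cutE: "edge_cut S \<omega> = real (card {(x, y). x \<in> S \<and> y \<in> ?T - S \<and> {x, y} \<in> G \<omega>})" if S: "S \<subseteq> ?T" for S
  proof -
    have "edge_cut S \<omega> = (\<Sum>z\<in>S \<times> (?T - S). if {fst z, snd z} \<in> G \<omega> then 1 else 0)"
      unfolding edge_cut_def of_bool_def using sub[OF S] by (simp add: sum.cartesian_product split_def)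
    also have "\<dots> = real (card (S \<times> (?T - S) \<inter> {z. {fst z, snd z} \<in> G \<omega>}))"
      using sub[OF S] by (simp add: sum.If_cases)
    also have "S \<times> (?T - S) \<inter> {z. {fst z, snd z} \<in> G \<omega>} = {(x, y). x \<in> S \<and> y \<in> ?T - S \<and> {x, y} \<in> G \<omega>}"
      by auto
    finally show ?thesis .
  qed
  define D where "D x = real (vertex_degree ?T (G \<omega>) x)" for x
  have D1: "1 \<le> D x" if x: "x \<in> ?T" for x
  proof -
    have "x mod N + 1 \<in> {y \<in> ?T. {x, y} \<in> G \<omega>}"
      using successor_neighbour[OF x N] cycle_present[OF \<omega>] by auto
    then have "0 < card {y \<in> ?T. {x, y} \<in> G \<omega>}" by (subst card_gt_0_iff) auto
    then show ?thesis by (simp add: D_def vertex_degree_def)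
  qed
  have noloop: "{x} \<notin> G \<omega>" for x
  proof
    assume "{x} \<in> G \<omega>"
    then have "{x} \<in> torus_pairs N" using edges_pairs[OF \<omega>] by blast
    then show False by (auto simp: torus_pairs_def)
  qed
  have DR: "D x \<le> R * wv.profile x" if x: "x \<in> ?T" for x
  proof (cases "?w x \<le> scale")
    case True
    \<comment> \<open>Rounding the weight up to a power of two at most doubles it, and the profile with it.\<close>
    define i where "i = dyadic_ceiling (?w x)"
    have "?w x \<le> 2 ^ levels" using True dyadic_ceiling[of scale] by (simp add: levels_def)
    then have i: "i \<le> levels" "?w x \<le> 2 ^ i" "2 ^ i \<le> 2 * ?w x"
      unfolding i_def using dyadic_ceiling_le dyadic_ceiling power_dyadic_ceiling_le[OF w1[OF x]] by auto
    have pr: "wv.profile x = real N * (?w x / scale) powr \<theta>"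
    proof -
      have "(?w x / scale) powr \<theta> \<le> 1 powr \<theta>"
        using True sc1 w1[OF x] th by (intro powr_mono2) auto
      then show ?thesis by (simp add: prof)
    qed
    have pr1: "1 \<le> wv.profile x"
    proof -
      have "1 \<le> real N powr (1 - \<alpha> * \<theta>)" using N1 th by (intro ge_one_powr_ge_zero) auto
      also have "\<dots> = real N * (1 / scale) powr \<theta>" by (rule minimal_profile[symmetric])
      also have "\<dots> \<le> real N * (?w x / scale) powr \<theta>"
        using w1[OF x] sc1 th by (intro mult_left_mono powr_mono2 divide_right_mono) auto
      finally show ?thesis by (simp add: pr)
    qed
    have "(2 ^ i / scale) powr \<theta> \<le> (2 * (?w x / scale)) powr \<theta>"
      using i sc1 th by (intro powr_mono2) (auto simp: divide_right_mono)
    also have "\<dots> = 2 powr \<theta> * (?w x / scale) powr \<theta>" by (rule powr_mult)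
    also have "\<dots> \<le> 2 * (?w x / scale) powr \<theta>"
      using powr_mono[of \<theta> 1 2] th by (intro mult_right_mono) auto
    finally have le: "(2 ^ i / scale) powr \<theta> \<le> 2 * (?w x / scale) powr \<theta>" .
    have "{y \<in> ?T. {x, y} \<in> G \<omega>} \<subseteq> {y \<in> ?T - {x}. {x, y} \<notin> cycle_edges N \<and> {x, y} \<in> G \<omega>}
        \<union> {y \<in> ?T. {x, y} \<in> cycle_edges N}"
      using noloop[of x] by auto
    then have "card {y \<in> ?T. {x, y} \<in> G \<omega>} \<le> free_degree x \<omega> + card {y \<in> ?T. {x, y} \<in> cycle_edges N}"
      unfolding free_degree_def by (intro order_trans[OF card_mono card_Un_le]) auto
    then have "D x \<le> real (free_degree x \<omega>) + 2"
      using card_cycle_neighbours[of N x] unfolding D_def vertex_degree_def by linarith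
    also have "real (free_degree x \<omega>) \<le> 4 * (log_factor * (real N * (2 ^ i / scale) powr \<theta>))"
      using reg x i unfolding regular_def by (simp add: less_imp_le)
    also have "\<dots> \<le> 4 * (log_factor * (real N * (2 * (?w x / scale) powr \<theta>)))"
      using le lf1 by (intro mult_left_mono) auto
    also have "\<dots> = 8 * (log_factor * wv.profile x)" by (simp add: pr)
    finally have 1: "D x \<le> 8 * (log_factor * wv.profile x) + 2" by simp
    have "1 * 1 \<le> log_factor * wv.profile x" using lf1 pr1 by (intro mult_mono) auto
    then show ?thesis using 1 unfolding R_def by simp
  next
    case False
    then have "1 \<le> (?w x / scale) powr \<theta>" using sc1 th by (intro ge_one_powr_ge_zero) auto
    then have "wv.profile x = real N" by (simp add: prof)
    moreover have "D x \<le> real N"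
    proof -
      have "card {y \<in> ?T. {x, y} \<in> G \<omega>} \<le> card ?T" by (intro card_mono) auto
      then show ?thesis by (simp add: D_def vertex_degree_def torus_def)
    qed
    moreover have "1 * real N \<le> R * real N" using lf1 unfolding R_def by (intro mult_right_mono) auto
    ultimately show ?thesis by simp
  qed
  have Q1: "1 \<le> Q" and R1: "1 \<le> R" unfolding Q_def R_def using lf1 by auto
  have sym: "edge_cut (?T - S) \<omega> = edge_cut S \<omega>" if "S \<subseteq> ?T" for S
  proof -
    have "?T - (?T - S) = S" using that by auto
    then show ?thesis unfolding edge_cut_def by (subst sum.swap) (simp add: insert_commute)
  qed
  have iso: "1 / (8 * Q * R) * min (sum D S) (sum D (?T - S)) \<le> edge_cut S \<omega>" if S: "S \<subseteq> ?T" for S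
  proof (rule cut_isoperimetry_of_mean_cut[where e = "\<lambda>S. edge_cut S \<omega>" and \<mu> = "\<lambda>S. expected_cut S \<omega>"
        and g = wv.profile and \<Gamma> = "real N powr (1 - \<alpha> * \<theta>)" and l = "log 2 N"])
    show "expected_cut (?T - S) \<omega> = expected_cut S \<omega>"
      using wv.mean_cut_complement[OF S] mean[OF S] mean[of "?T - S"] by auto
    show "0 \<le> edge_cut S \<omega>" unfolding edge_cut_def by (intro sum_nonneg) auto
    show "real N powr (1 - \<alpha> * \<theta>) \<le> wv.profile x" if x: "x \<in> ?T" for x
    proof -
      have a: "(1 / scale) powr \<theta> \<le> (?w x / scale) powr \<theta>"
        using w1[OF x] sc1 th by (intro powr_mono2 divide_right_mono) auto
      have b: "(1 / scale) powr \<theta> \<le> 1 powr \<theta>" using sc1 th by (intro powr_mono2) auto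
      have "real N * (1 / scale) powr \<theta> \<le> wv.profile x"
        unfolding prof using a b by (intro mult_left_mono) auto
      then show ?thesis by (simp only: minimal_profile)
    qed
    show "expected_cut S \<omega> / 4 - 4 * real (card S) * log 2 N \<le> edge_cut S \<omega>" if "S \<subseteq> ?T" "S \<noteq> {}" for S
      using reg that unfolding regular_def by blast
    show "0 < real N powr (1 - \<alpha> * \<theta>)" "0 \<le> log 2 N" using N by auto
  qed (use S sym isoW DR Q1 R1 large in auto)
  define h where "h = 1 / (8 * Q * R)"
  have QR: "1 * 1 \<le> Q * R" using Q1 R1 by (intro mult_mono) auto
  show ?thesis
  proof (rule t_mix_le_of_isoperimetry[where h = h])
    show "0 < h" "h \<le> 1" unfolding h_def using QR by auto
    show "?T \<noteq> {}" using N by (simp add: torus_def)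
    have "8 / h\<^sup>2 = 512 * Q\<^sup>2 * R\<^sup>2"
      unfolding h_def using Q1 R1 by (simp add: power_divide power_mult_distrib)
    then show "8 / h\<^sup>2 * ln (4 * (real (card ?T))\<^sup>2) \<le> real n" using n by (simp add: torus_def)
    fix S assume S: "S \<subseteq> ?T"
    show "h * min (\<Sum>x\<in>S. real (vertex_degree ?T (G \<omega>) x)) (\<Sum>x\<in>?T - S. real (vertex_degree ?T (G \<omega>) x))
      \<le> real (card {(x, y). x \<in> S \<and> y \<in> ?T - S \<and> {x, y} \<in> G \<omega>})"
      using iso[OF S] unfolding h_def D_def cutE[OF S] .
  qed (use noloop D1 in \<open>auto simp: D_def\<close>)
qed

end
end

section \<open>Polylogarithmic mixing\<close>

theorem theorem2p2:
  fixes M :: "'a measure" and \<alpha> \<tau> :: real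
    and W :: "nat \<Rightarrow> nat \<Rightarrow> 'a \<Rightarrow> real" and G :: "nat \<Rightarrow> 'a \<Rightarrow> nat set set"
  assumes "\<tau> > 1" and "\<alpha> > 0" and "\<alpha> * (\<tau> - 1) < 1"
    and "\<And>N. N \<ge> 1 \<Longrightarrow> scale_free_percolation M \<alpha> \<tau> N (W N) (G N)"
  shows "\<exists>c>0. AE \<omega> in M. \<forall>\<^sub>F N in sequentially.
           ereal_of_enat (t_mix (torus N) (G N \<omega>)) \<le> ereal (ln (real N) powr c)"
proof -
  define th where "th = min 1 (\<tau> - 1)"
  define \<kappa> where "\<kappa> = 1 - \<alpha> * th"
  define \<delta> where "\<delta> = 1 - \<alpha> * (\<tau> - 1)"
  define b where "b = 2 powr (- (\<tau> - 1)) / 4"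
  have pos: "0 < \<kappa>" "0 < \<delta>" "0 < b"
  proof -
    have "\<alpha> * th \<le> \<alpha> * (\<tau> - 1)" unfolding th_def using assms(2) by (intro mult_left_mono) auto
    then show "0 < \<kappa>" "0 < \<delta>" using assms(3) by (auto simp: \<kappa>_def \<delta>_def)
    show "0 < b" by (simp add: b_def)
  qed
  define lev where "lev N = \<alpha> * log 2 (real N) + 2" for N
  define Q where "Q N = 2048 * lev N" for N
  define R where "R N = 10 * ((2 * (log 2 (real N) + 1) + 1) * (4 * (1 + ln (real N))))" for N
  have ev1: "eventually (\<lambda>N. real N * lev N * exp (- (real N powr \<kappa>)) + 2 / real N ^ 3
       + 4 * lev N * exp (- (real N powr \<delta> * b)) \<le> 1 / real N ^ 2) at_top"
  proof -
    have "eventually (\<lambda>N. real N * lev N * exp (- (real N powr \<kappa>)) \<le> 1 / (4 * real N ^ 2)) at_top"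
      unfolding lev_def using pos(1) assms(2) by real_asymp
    moreover have "eventually (\<lambda>N. 4 * lev N * exp (- (real N powr \<delta> * b)) \<le> 1 / (4 * real N ^ 2)) at_top"
      unfolding lev_def using pos(2,3) assms(2) by real_asymp
    moreover have "eventually (\<lambda>N. 2 / real N ^ 3 \<le> 1 / (4 * real N ^ 2)) at_top"
      by real_asymp
    moreover have "eventually (\<lambda>N. 0 \<le> 1 / (4 * real N ^ 2)) at_top" by simp
    ultimately show ?thesis
    proof eventually_elim
      case (elim N)
      have "1 / real N ^ 2 = 4 * (1 / (4 * real N ^ 2))" by simp
      then show ?case using elim by linarith
    qed
  qed
  have ev2: "eventually (\<lambda>N. 32 * Q N * log 2 (real N) \<le> real N powr \<kappa>) at_top"
    unfolding Q_def lev_def using pos assms(2) by real_asymp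
  have ev3: "eventually (\<lambda>N. 512 * (Q N)\<^sup>2 * (R N)\<^sup>2 * ln (4 * (real N)\<^sup>2) + 1 \<le> ln (real N) powr 8) at_top"
    unfolding Q_def R_def lev_def using assms(2) by real_asymp
  have "eventually (\<lambda>N::nat. 2 \<le> N) at_top" by (rule eventually_ge_at_top)
  then have "eventually (\<lambda>N. 2 \<le> N \<and> real N * lev N * exp (- (real N powr \<kappa>)) + 2 / real N ^ 3
       + 4 * lev N * exp (- (real N powr \<delta> * b)) \<le> 1 / real N ^ 2 \<and> 32 * Q N * log 2 (real N) \<le> real N powr \<kappa>
       \<and> 512 * (Q N)\<^sup>2 * (R N)\<^sup>2 * ln (4 * (real N)\<^sup>2) + 1 \<le> ln (real N) powr 8) at_top"
    using ev1 ev2 ev3 by eventually_elim simp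
  then obtain N0 where N0: "\<And>N. N0 \<le> N \<Longrightarrow> 2 \<le> N \<and> real N * lev N * exp (- (real N powr \<kappa>)) + 2 / real N ^ 3
       + 4 * lev N * exp (- (real N powr \<delta> * b)) \<le> 1 / real N ^ 2 \<and> 32 * Q N * log 2 (real N) \<le> real N powr \<kappa>
       \<and> 512 * (Q N)\<^sup>2 * (R N)\<^sup>2 * ln (4 * (real N)\<^sup>2) + 1 \<le> ln (real N) powr 8"
    unfolding eventually_sequentially by blast
  let ?fast = "\<lambda>N \<omega>. ereal_of_enat (t_mix (torus N) (G N \<omega>)) \<le> ereal (ln (real N) powr 8)"
  have "\<exists>B\<in>sets M. measure M B \<le> 1 / real N ^ 2 \<and> (\<forall>\<omega>\<in>space M - B. ?fast N \<omega>)" if N: "N0 \<le> N" for N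
  proof -
    have N2: "2 \<le> N" using N0[OF N] by simp
    then interpret scale_free_percolation M \<alpha> \<tau> N "W N" "G N" using assms(4) by simp
    note ass = assms(1-3) N2
    have th: "\<theta> = th" by (simp add: \<theta>_def th_def)
    have N1: "1 \<le> real N" using N2 by simp
    have lev: "real levels + 1 \<le> lev N"
      using dyadic_ceiling_le_log[OF scale_ge_1[OF ass]] N2
      by (simp add: levels_def lev_def scale_def log_powr)
    have QN: "2048 * (real levels + 1) \<le> Q N" unfolding Q_def using lev by simp
    have RN: "10 * log_factor \<le> R N"
      unfolding R_def log_factor_def using dyadic_ceiling_le_log[OF N1] N1
      by (intro mult_left_mono mult_right_mono) auto
    obtain B where B: "B \<in> sets M" "\<And>\<omega>. \<omega> \<in> space M - B \<Longrightarrow> regular \<omega>"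
      "measure M B \<le> real N * (real levels + 1) * exp (- (real N powr (1 - \<alpha> * \<theta>))) + 2 / real N ^ 3
       + 4 * (real levels + 1) * exp (- (real N powr (1 - \<alpha> * (\<tau> - 1)) * 2 powr (- (\<tau> - 1)) / 4))"
      using not_regular_prob[OF ass] by blast
    have "measure M B \<le> real N * lev N * exp (- (real N powr \<kappa>)) + 2 / real N ^ 3
       + 4 * lev N * exp (- (real N powr \<delta> * b))"
    proof -
      have "real N * (real levels + 1) * exp (- (real N powr \<kappa>)) \<le> real N * lev N * exp (- (real N powr \<kappa>))"
        using lev by (intro mult_left_mono mult_right_mono) auto
      moreover have "4 * (real levels + 1) * exp (- (real N powr \<delta> * b)) \<le> 4 * lev N * exp (- (real N powr \<delta> * b))"
        using lev by (intro mult_left_mono mult_right_mono) auto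
      moreover have "measure M B \<le> real N * (real levels + 1) * exp (- (real N powr \<kappa>)) + 2 / real N ^ 3
         + 4 * (real levels + 1) * exp (- (real N powr \<delta> * b))"
        using B(3) unfolding th \<kappa>_def \<delta>_def b_def by (simp only: times_divide_eq_right)
      ultimately show ?thesis by linarith
    qed
    then have "measure M B \<le> 1 / real N ^ 2" using N0[OF N] by linarith
    moreover have "?fast N \<omega>" if \<omega>: "\<omega> \<in> space M - B" for \<omega>
    proof -
      define n where "n = nat \<lceil>512 * (Q N)\<^sup>2 * (R N)\<^sup>2 * ln (4 * (real N)\<^sup>2)\<rceil>"
      have lnN: "0 \<le> ln (4 * (real N)\<^sup>2)"
        using one_le_power[OF N1, of 2] by simp
      have lf: "0 \<le> log_factor" using log_factor_ge_1[OF ass] by simp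
      have "t_mix (torus N) (G N \<omega>) \<le> enat n"
      proof (rule regular_t_mix[OF ass])
        show "\<omega> \<in> space M" "regular \<omega>" using \<omega> B(2) by auto
        have "32 * (2048 * (real levels + 1)) * log 2 N \<le> 32 * Q N * log 2 N"
          using QN N1 by (intro mult_right_mono) auto
        then show "32 * (2048 * (real levels + 1)) * log 2 N \<le> real N powr (1 - \<alpha> * \<theta>)"
          using N0[OF N] unfolding th \<kappa>_def by linarith
        have "512 * (2048 * (real levels + 1))\<^sup>2 * (10 * log_factor)\<^sup>2 * ln (4 * (real N)\<^sup>2)
            \<le> 512 * (Q N)\<^sup>2 * (R N)\<^sup>2 * ln (4 * (real N)\<^sup>2)"
          using QN RN lf lnN by (intro mult_right_mono mult_mono mult_left_mono power_mono) auto
        also have "\<dots> \<le> real n" unfolding n_def by linarith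
        finally show "512 * (2048 * (real levels + 1))\<^sup>2 * (10 * log_factor)\<^sup>2 * ln (4 * (real N)\<^sup>2) \<le> real n" .
      qed
      then have "ereal_of_enat (t_mix (torus N) (G N \<omega>)) \<le> ereal_of_enat (enat n)"
        by (simp only: ereal_of_enat_le_iff)
      also have "\<dots> = ereal (real n)" by simp
      also have "real n \<le> 512 * (Q N)\<^sup>2 * (R N)\<^sup>2 * ln (4 * (real N)\<^sup>2) + 1"
        unfolding n_def using lnN by (simp add: nat_ceiling_le_eq)
      also have "\<dots> \<le> ln (real N) powr 8" using N0[OF N] by blast
      finally show ?thesis by simp
    qed
    ultimately show ?thesis using B(1) by blast
  qed
  then obtain B where B: "\<And>N. N0 \<le> N \<Longrightarrow> B N \<in> sets M" "\<And>N. N0 \<le> N \<Longrightarrow> measure M (B N) \<le> 1 / real N ^ 2"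
    "\<And>N \<omega>. N0 \<le> N \<Longrightarrow> \<omega> \<in> space M - B N \<Longrightarrow> ?fast N \<omega>"
    by metis
  interpret sfp: scale_free_percolation M \<alpha> \<tau> 1 "W 1" "G 1" using assms(4) by simp
  \<comment> \<open>The asymptotic bounds hold from \<open>N0\<close> on; smaller \<open>N\<close> do not matter in the limit.\<close>
  define B' where "B' N = (if N0 \<le> N then B N else {})" for N
  have "AE \<omega> in M. eventually (\<lambda>N. \<omega> \<in> space M - B' N) sequentially"
  proof (rule borel_cantelli_AE1)
    show "B' N \<in> sets M" for N using B(1) by (simp add: B'_def)
    show "emeasure M (B' N) < \<infinity>" for N by (simp add: sfp.emeasure_eq_measure)
    have "summable (\<lambda>N. 1 / real N ^ 2)" using inverse_power_summable[of 2, where 'a = real]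
      by (simp add: inverse_eq_divide)
    then show "summable (\<lambda>N. measure M (B' N))"
      by (rule summable_comparison_test[rotated])
         (use B(2) in \<open>auto simp: B'_def intro!: exI[of _ N0]\<close>)
  qed
  then have "AE \<omega> in M. eventually (\<lambda>N. ?fast N \<omega>) sequentially"
  proof eventually_elim
    case (elim \<omega>)
    then show ?case using eventually_ge_at_top[of N0]
      by eventually_elim (use B(3) in \<open>auto simp: B'_def\<close>)
  qed
  then show ?thesis by (intro exI[of _ 8]) auto
qed

end
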